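(* Let $X$ be a (finite) cell complex, let $\ell\ge1$ be an integer and let $K$ be a field. For $p\in(0,1)$ and $q\ge 1$, the $\ell$-random-cluster measure $\mu_{p,q}$ on $X$ with $K$ coefficient is positively associated, i.e., $$\mu_{p,q}(fg)\ge\mu_{p,q}(f)\,\mu_{p,q}(g)$$ for any increasing functions $f,g:\Omega_\ell(X)\to\mathbb{R}$.
   Context: All cell complexes are finite. $X_\ell$ denotes the set of $\ell$-cells of $X$ and $X^{\ell-1}$ its $(\ell-1)$-skeleton. For $F\subset X_\ell$ put $X_F=X^{\ell-1}\sqcup F$, and $\Omega_\ell(X)=\{X_F: F\subset X_\ell\}$, partially ordered by inclusion (identified with $\{0,1\}^{X_\ell}$). A function $f:\Omega_\ell(X)\to\mathbb{R}$ is increasing if $f(Y)\le f(Y')$ whenever $Y\subset Y'$. For $p\in[0,1]$ and $q>0$, the $\ell$-random-cluster measure on $X$ with $K$ coefficient is the probability measure on $\Omega_\ell(X)$ $$\mu_{p,q}(Y)=\frac{1}{Z_{p,q}}\,p^{|Y_\ell|}(1-p)^{|X_\ell\setminus Y_\ell|}\,q^{\beta_{\ell-1}(Y)},\qquad Y\in\Omega_\ell(X),$$ where $Y_\ell$ is the set of $\ell$-cells of $Y$, $\beta_{\ell-1}(Y)=\dim_K H_{\ell-1}(Y;K)$ is the (non-reduced) Betti number with coefficients in $K$, and $Z_{p,q}$ is the normalizing constant. $\mu_{p,q}(f)$ denotes the expectation of $f$ under $\mu_{p,q}$. *)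

theory Defs
  imports
    "HOL-Analysis.Analysis"
    "HOL-Homology.Homology"
    "Jordan_Normal_Form.VS_Connect"
begin

section \<open>Finite cell complexes\<close>

definition closed_disc :: "nat \<Rightarrow> (nat \<Rightarrow> real) set" where
  "closed_disc n = {x \<in> topspace (Euclidean_space n). (\<Sum>i<n. (x i)\<^sup>2) \<le> 1}"

definition open_disc :: "nat \<Rightarrow> (nat \<Rightarrow> real) set" where
  "open_disc n = {x \<in> topspace (Euclidean_space n). (\<Sum>i<n. (x i)\<^sup>2) < 1}"

text \<open>
  Cells are named by elements of an index type. Each cell \<open>c\<close> comes with its dimension and a
  characteristic map defined on the closed disc of that dimension.
\<close>

record ('a, 'c) cell_complex =
  total_space :: "'a topology"
  cells :: "'c set"
  cell_dim :: "'c \<Rightarrow> nat"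
  char_map :: "'c \<Rightarrow> (nat \<Rightarrow> real) \<Rightarrow> 'a"

definition open_cell :: "('a, 'c) cell_complex \<Rightarrow> 'c \<Rightarrow> 'a set" where
  "open_cell X c = char_map X c ` open_disc (cell_dim X c)"

text \<open>
  The usual description of a finite CW structure on a Hausdorff space. With finitely many cells,
  closure finiteness and the weak topology are automatic, and by compactness the characteristic
  maps restrict to homeomorphisms from the open discs onto the open cells.
\<close>

locale finite_cell_complex =
  fixes X :: "('a, 'c) cell_complex"
  assumes Hausdorff: "Hausdorff_space (total_space X)"
    and finite_cells: "finite (cells X)"
    and continuous_char_map: "c \<in> cells X \<Longrightarrow>
      continuous_map (subtopology (Euclidean_space (cell_dim X c)) (closed_disc (cell_dim X c)))
        (total_space X) (char_map X c)"
    and inj_on_char_map: "c \<in> cells X \<Longrightarrow> inj_on (char_map X c) (open_disc (cell_dim X c))"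
    and disjoint_open_cells: "disjoint_family_on (open_cell X) (cells X)"
    and Union_open_cells: "(\<Union>c\<in>cells X. open_cell X c) = topspace (total_space X)"
    and char_map_boundary: "c \<in> cells X \<Longrightarrow>
      char_map X c ` (closed_disc (cell_dim X c) - open_disc (cell_dim X c)) \<subseteq>
        (\<Union>c'\<in>{c' \<in> cells X. cell_dim X c' < cell_dim X c}. open_cell X c')"

text \<open>
  A subcomplex is represented by its set \<open>Y\<close> of cells; since the open cells partition the space,
  inclusion of subcomplexes is inclusion of these sets.
\<close>

definition subcomplex_space :: "('a, 'c) cell_complex \<Rightarrow> 'c set \<Rightarrow> 'a topology" where
  "subcomplex_space X Y = subtopology (total_space X) (\<Union>c\<in>Y. open_cell X c)"

definition skeleton :: "('a, 'c) cell_complex \<Rightarrow> nat \<Rightarrow> 'c set" where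
  "skeleton X k = {c \<in> cells X. cell_dim X c \<le> k}"

definition cells_of_dim :: "('a, 'c) cell_complex \<Rightarrow> nat \<Rightarrow> 'c set \<Rightarrow> 'c set" where
  "cells_of_dim X k Y = {c \<in> Y. cell_dim X c = k}"

section \<open>Singular homology with coefficients in a field\<close>

text \<open>
  The library's singular homology has integer coefficients. The definitions below are its
  counterparts over a field, on the same singular simplices and faces.
\<close>

type_synonym ('a, 'k) field_chain = "((nat \<Rightarrow> real) \<Rightarrow> 'a) \<Rightarrow>\<^sub>0 'k"

definition field_chains :: "nat \<Rightarrow> 'a topology \<Rightarrow> ('a, 'k::field) field_chain set" where
  "field_chains n T = {c. Poly_Mapping.keys c \<subseteq> singular_simplex_set n T}"

definition field_boundary :: "nat \<Rightarrow> ('a, 'k::field) field_chain \<Rightarrow> ('a, 'k) field_chain" where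
  "field_boundary n c =
    (if n = 0 then 0
     else \<Sum>\<sigma>\<in>Poly_Mapping.keys c. \<Sum>k\<le>n.
       Poly_Mapping.single (singular_face n k \<sigma>) ((- 1) ^ k * Poly_Mapping.lookup c \<sigma>))"

definition field_cycles :: "nat \<Rightarrow> 'a topology \<Rightarrow> ('a, 'k::field) field_chain set" where
  "field_cycles n T = {c \<in> field_chains n T. field_boundary n c = 0}"

definition field_boundaries :: "nat \<Rightarrow> 'a topology \<Rightarrow> ('a, 'k::field) field_chain set" where
  "field_boundaries n T = field_boundary (Suc n) ` field_chains (Suc n) T"

definition homology_class ::
  "nat \<Rightarrow> 'a topology \<Rightarrow> ('a, 'k::field) field_chain \<Rightarrow> ('a, 'k) field_chain set" where
  "homology_class n T z = (\<lambda>b. z + b) ` field_boundaries n T"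

text \<open>
  The quotient of cycles by boundaries as a vector space over the field \<open>class_ring\<close>, i.e. over
  the type \<open>'k\<close>. Scalar multiples are again closed up to full cosets, so that \<open>0\<close> times a class
  is the zero class. The ring fields \<open>mult\<close> and \<open>one\<close> play no role in a module.
\<close>

definition field_homology ::
  "nat \<Rightarrow> 'a topology \<Rightarrow> ('k::field, ('a, 'k) field_chain set) module" where
  "field_homology n T =
    \<lparr>carrier = homology_class n T ` field_cycles n T,
     mult = undefined,
     one = undefined,
     zero = field_boundaries n T,
     add = (\<lambda>A B. {a + b | a b. a \<in> A \<and> b \<in> B}),
     smult = (\<lambda>r A. {Poly_Mapping.map ((*) r) a + b | a b. a \<in> A \<and> b \<in> field_boundaries n T})\<rparr>"

definition betti :: "'k::field itself \<Rightarrow> nat \<Rightarrow> 'a topology \<Rightarrow> nat" where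
  "betti _ n T =
    vectorspace.dim (class_ring :: 'k ring)
      (field_homology n T :: ('k, ('a, 'k) field_chain set) module)"

section \<open>The random-cluster measure\<close>

definition configurations :: "('a, 'c) cell_complex \<Rightarrow> nat \<Rightarrow> 'c set set" where
  "configurations X l = {skeleton X (l - 1) \<union> F | F. F \<subseteq> cells_of_dim X l (cells X)}"

definition rc_weight ::
  "'k::field itself \<Rightarrow> ('a, 'c) cell_complex \<Rightarrow> nat \<Rightarrow> real \<Rightarrow> real \<Rightarrow> 'c set \<Rightarrow> real" where
  "rc_weight K X l p q Y =
    p ^ card (cells_of_dim X l Y) *
    (1 - p) ^ card (cells_of_dim X l (cells X) - cells_of_dim X l Y) *
    q ^ betti K (l - 1) (subcomplex_space X Y)"

definition rc_partition ::
  "'k::field itself \<Rightarrow> ('a, 'c) cell_complex \<Rightarrow> nat \<Rightarrow> real \<Rightarrow> real \<Rightarrow> real" where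
  "rc_partition K X l p q = (\<Sum>Y\<in>configurations X l. rc_weight K X l p q Y)"

definition rc_measure ::
  "'k::field itself \<Rightarrow> ('a, 'c) cell_complex \<Rightarrow> nat \<Rightarrow> real \<Rightarrow> real \<Rightarrow> 'c set measure" where
  "rc_measure K X l p q =
    point_measure (configurations X l)
      (\<lambda>Y. ennreal (rc_weight K X l p q Y / rc_partition K X l p q))"

end

(*
The boundaries of the l-cells, attached one at a time along their characteristic maps, are cycles
z_e in the (l-1)-skeleton, and H_(l-1) of the skeleton with the cells F attached is the quotient of
H_(l-1) of the skeleton by the span of the z_e with e in F. The codimension of a span is a
supermodular function of F, so that for q >= 1 the weights satisfy the FKG lattice condition, and
positive association follows from the four functions theorem.

The description of the homology needs H_k of a cell relative to its boundary sphere with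
coefficients in K. It vanishes for k < l and is cyclic for k = l over the integers. An integral
chain complex that is acyclic below degree m has a partial contraction, and extending this
contraction K-linearly shows that the relative cycles of degree m over K are spanned by the
integral ones, modulo chains of the subspace.
*)
theory Submission
  imports Defs
begin

section \<open>The four functions theorem\<close>

text \<open>Over K, a relative cycle of degree m need not be a combination of integral relative
  cycles modulo the subspace: coefficients may cancel in K without cancelling in the integers. In
  the universal coefficient theorem this failure is the Tor term of the integral homology in degree
  m - 1. Vanishing of the integral homology below degree m removes that term, and the partial
  contraction makes the removal explicit on chains.

  The exact sequence of the pair is likewise unfolded on chains. Vanishing of the relative homology
  in degree l - 1 says that every (l-1)-cycle can be moved into the space before the attachment,
  modulo boundaries; cyclicity in degree l says that a cycle there which becomes a boundary is,
  modulo old boundaries, a multiple of z_e. Both statements survive attaching one cell after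
  another, since the boundary of an l-cell always lies in the skeleton.\<close>

lemma four_functions_two_point:
  fixes a0 a1 b0 b1 c0 c1 d0 d1 :: real
  assumes nonneg: "0 \<le> a0" "0 \<le> a1" "0 \<le> b0" "0 \<le> b1" "0 \<le> c0" "0 \<le> c1" "0 \<le> d0" "0 \<le> d1"
    and 00: "a0 * b0 \<le> c0 * d0" and 01: "a0 * b1 \<le> c1 * d0"
    and 10: "a1 * b0 \<le> c1 * d0" and 11: "a1 * b1 \<le> c1 * d1"
  shows "(a0 + a1) * (b0 + b1) \<le> (c0 + c1) * (d0 + d1)"
proof -
  define x y m where "x = a0 * b1" and "y = a1 * b0" and "m = c1 * d0"
  have le: "0 \<le> x" "0 \<le> y" "x \<le> m" "y \<le> m"
    using nonneg 01 10 by (auto simp: x_def y_def m_def)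
  have xy: "x * y \<le> m * (c0 * d1)"
    using mult_mono[OF 00 11] nonneg by (simp add: x_def y_def m_def algebra_simps)
  have "x + y \<le> m + c0 * d1"
  proof (cases "m = 0")
    case True
    then show ?thesis using le nonneg by simp
  next
    case False
    \<comment> \<open>Both \<open>x\<close> and \<open>y\<close> are at most \<open>m\<close>, and
      \<open>x * y\<close> regroups as \<open>(a0 * b0) * (a1 * b1)\<close>, which \<open>00\<close>
      and \<open>11\<close> bound by \<open>m * (c0 * d1)\<close>. Expanding this product turns the
      two bounds into one for \<open>x + y\<close>.\<close>
    have "0 \<le> (m - x) * (m - y)" using le by simp
    then have "m * (x + y) \<le> m * (m + c0 * d1)" using xy by (simp add: algebra_simps)
    then show ?thesis using False le by (simp add: mult_le_cancel_left)
  qed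
  then show ?thesis using 00 11 by (simp add: x_def y_def m_def algebra_simps)
qed

lemma sum_Pow_insert:
  fixes f :: "'c set \<Rightarrow> 'b::comm_monoid_add"
  assumes "finite E" "e \<notin> E"
  shows "sum f (Pow (insert e E)) = (\<Sum>A\<in>Pow E. f A + f (insert e A))"
proof -
  have "sum f (Pow (insert e E)) = sum f (Pow E) + sum f (insert e ` Pow E)"
    unfolding Pow_insert using assms by (intro sum.union_disjoint) auto
  moreover have "inj_on (insert e) (Pow E)"
    using assms by (auto simp: inj_on_def)
  ultimately show ?thesis by (simp add: sum.reindex sum.distrib)
qed

text \<open>Ahlswede-Daykin. Summing out \<open>e\<close> preserves the hypothesis: for fixed
  \<open>A\<close> and \<open>B\<close> this is the two-point inequality, with indices recording
  whether \<open>e\<close> belongs to the set. In both mixed cases the union contains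
  \<open>e\<close> and the intersection does not, which is why \<open>c1 * d0\<close> bounds two of
  the products.\<close>

lemma four_functions:
  fixes \<alpha> \<beta> \<gamma> \<delta> :: "'c set \<Rightarrow> real"
  assumes "finite E"
    and "\<And>A. A \<subseteq> E \<Longrightarrow> 0 \<le> \<alpha> A \<and> 0 \<le> \<beta> A \<and> 0 \<le> \<gamma> A \<and> 0 \<le> \<delta> A"
    and "\<And>A B. A \<subseteq> E \<Longrightarrow> B \<subseteq> E \<Longrightarrow> \<alpha> A * \<beta> B \<le> \<gamma> (A \<union> B) * \<delta> (A \<inter> B)"
  shows "sum \<alpha> (Pow E) * sum \<beta> (Pow E) \<le> sum \<gamma> (Pow E) * sum \<delta> (Pow E)"
  using assms
proof (induction E arbitrary: \<alpha> \<beta> \<gamma> \<delta> rule: finite_induct)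
  case empty
  then show ?case by force
next
  case (insert e E)
  let ?m = "\<lambda>f A. f A + f (insert e A) :: real"
  have "sum (?m \<alpha>) (Pow E) * sum (?m \<beta>) (Pow E) \<le> sum (?m \<gamma>) (Pow E) * sum (?m \<delta>) (Pow E)"
  proof (rule insert.IH)
    fix A assume A: "A \<subseteq> E"
    then have "A \<subseteq> insert e E" "insert e A \<subseteq> insert e E" by auto
    then show "0 \<le> ?m \<alpha> A \<and> 0 \<le> ?m \<beta> A \<and> 0 \<le> ?m \<gamma> A \<and> 0 \<le> ?m \<delta> A"
      using insert.prems(1) by (simp add: add_nonneg_nonneg)
    fix B assume B: "B \<subseteq> E"
    have sub: "A \<subseteq> insert e E" "insert e A \<subseteq> insert e E" "B \<subseteq> insert e E" "insert e B \<subseteq> insert e E"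
      "A \<union> B \<subseteq> insert e E" "A \<inter> B \<subseteq> insert e E"
      "insert e (A \<union> B) \<subseteq> insert e E" "insert e (A \<inter> B) \<subseteq> insert e E"
      using A B by auto
    have [simp]: "A \<inter> insert e B = A \<inter> B" "insert e A \<inter> B = A \<inter> B"
      using A B insert.hyps by auto
    note pos = insert.prems(1)[OF sub(1)] insert.prems(1)[OF sub(2)] insert.prems(1)[OF sub(3)]
      insert.prems(1)[OF sub(4)] insert.prems(1)[OF sub(5)] insert.prems(1)[OF sub(6)]
      insert.prems(1)[OF sub(7)] insert.prems(1)[OF sub(8)]
    show "?m \<alpha> A * ?m \<beta> B \<le> ?m \<gamma> (A \<union> B) * ?m \<delta> (A \<inter> B)"
      by (rule four_functions_two_point)
        (use pos insert.prems(2)[OF sub(1,3)] insert.prems(2)[OF sub(1,4)]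
          insert.prems(2)[OF sub(2,3)] insert.prems(2)[OF sub(2,4)] in auto)
  qed
  then show ?case using insert.hyps by (simp add: sum_Pow_insert)
qed

text \<open>The four functions theorem for \<open>f w\<close>, \<open>g w\<close>,
  \<open>f g w\<close> and \<open>w\<close>, where monotonicity moves \<open>f\<close> and
  \<open>g\<close> up to the union.\<close>

lemma FKG_sum:
  fixes w f g :: "'c set \<Rightarrow> real"
  assumes E: "finite E"
    and w: "\<And>A. A \<subseteq> E \<Longrightarrow> 0 \<le> w A"
    and lattice: "\<And>A B. A \<subseteq> E \<Longrightarrow> B \<subseteq> E \<Longrightarrow> w A * w B \<le> w (A \<union> B) * w (A \<inter> B)"
    and f: "monotone_on (Pow E) (\<subseteq>) (\<le>) f" and g: "monotone_on (Pow E) (\<subseteq>) (\<le>) g"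
  shows "(\<Sum>A\<in>Pow E. f A * w A) * (\<Sum>A\<in>Pow E. g A * w A)
    \<le> (\<Sum>A\<in>Pow E. f A * g A * w A) * sum w (Pow E)"
proof -
  have mono: "h A \<le> h B" if "monotone_on (Pow E) (\<subseteq>) (\<le>) h" "A \<subseteq> B" "B \<subseteq> E"
    for h :: "'c set \<Rightarrow> real" and A B
    using that by (auto simp: monotone_on_def)
  \<comment> \<open>The four functions must be nonnegative. Subtracting the values at the least set
    \<open>{}\<close> ensures this, and a covariance does not change when constants are
    subtracted.\<close>
  define f' g' where "f' = (\<lambda>A. f A - f {})" and "g' = (\<lambda>A. g A - g {})"
  have f': "0 \<le> f' A" "f' A \<le> f' B" if "A \<subseteq> B" "B \<subseteq> E" for A B
    using mono[OF f, of A B] mono[OF f, of "{}" A] that by (auto simp: f'_def)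
  have g': "0 \<le> g' A" "g' A \<le> g' B" if "A \<subseteq> B" "B \<subseteq> E" for A B
    using mono[OF g, of A B] mono[OF g, of "{}" A] that by (auto simp: g'_def)
  have le: "(\<Sum>A\<in>Pow E. f' A * w A) * (\<Sum>A\<in>Pow E. g' A * w A)
    \<le> (\<Sum>A\<in>Pow E. f' A * g' A * w A) * sum w (Pow E)"
  proof (rule four_functions[OF E])
    fix A assume A: "A \<subseteq> E"
    then show "0 \<le> f' A * w A \<and> 0 \<le> g' A * w A \<and> 0 \<le> f' A * g' A * w A \<and> 0 \<le> w A"
      using f'(1) g'(1) w by simp
    fix B assume B: "B \<subseteq> E"
    have "f' A * g' B * (w A * w B) \<le> f' (A \<union> B) * g' (A \<union> B) * (w (A \<union> B) * w (A \<inter> B))"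
      by (rule mult_mono[OF mult_mono lattice])
        (use A B f'[of A "A \<union> B"] f'[of "A \<union> B" "A \<union> B"] g'[of B "A \<union> B"] in \<open>auto simp: w\<close>)
    then show "f' A * w A * (g' B * w B) \<le> f' (A \<union> B) * g' (A \<union> B) * w (A \<union> B) * w (A \<inter> B)"
      by (simp add: algebra_simps)
  qed
  have eqs: "(\<Sum>A\<in>Pow E. f' A * w A) = (\<Sum>A\<in>Pow E. f A * w A) - f {} * sum w (Pow E)"
    "(\<Sum>A\<in>Pow E. g' A * w A) = (\<Sum>A\<in>Pow E. g A * w A) - g {} * sum w (Pow E)"
    by (simp_all add: f'_def g'_def left_diff_distrib sum_subtractf sum_distrib_left)
  have eq: "(\<Sum>A\<in>Pow E. f' A * g' A * w A) = (\<Sum>A\<in>Pow E. f A * g A * w A)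
      - f {} * (\<Sum>A\<in>Pow E. g A * w A) - g {} * (\<Sum>A\<in>Pow E. f A * w A) + f {} * g {} * sum w (Pow E)"
    by (simp add: f'_def g'_def sum_distrib_left algebra_simps flip: sum.distrib sum_subtractf)
  show ?thesis using le unfolding eqs eq by (simp add: algebra_simps)
qed

section \<open>Codimension of spans\<close>

text \<open>Compares least sizes of generating sets. Passing from \<open>Q\<close> back to
  \<open>P\<close> may shrink the size, as images of sets do; if neither predicate can be satisfied,
  both sides are the same default value.\<close>

lemma LEAST_eqI:
  fixes P Q :: "nat \<Rightarrow> bool"
  assumes "\<And>k. P k \<Longrightarrow> Q k" "\<And>k. Q k \<Longrightarrow> \<exists>j\<le>k. P j"
  shows "(LEAST k. P k) = (LEAST k. Q k)"
proof (cases "\<exists>k. P k")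
  case True
  then show ?thesis
    by (metis (mono_tags, lifting) LeastI_ex Least_le assms order_antisym order_trans)
next
  case False
  then have "P = Q" using assms by blast
  then show ?thesis by simp
qed

locale coranked_space = vector_space scale
  for scale :: "'a::field \<Rightarrow> 'b::ab_group_add \<Rightarrow> 'b"
begin

definition cospans :: "'b set \<Rightarrow> 'b set \<Rightarrow> 'b set \<Rightarrow> bool"
  where "cospans Z S A \<longleftrightarrow> finite A \<and> A \<subseteq> Z \<and> Z \<subseteq> span (A \<union> S)"

text \<open>
  If no finite set cospans, then \<open>corank Z S\<close> is the junk value \<open>LEAST k. False\<close>. This value does
  not depend on \<open>S\<close>, and enlarging \<open>S\<close> by finitely many vectors does not create a finite cospanning
  set, so supermodularity below needs no finiteness of \<open>Z\<close>.
\<close>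

definition corank :: "'b set \<Rightarrow> 'b set \<Rightarrow> nat"
  where "corank Z S = (LEAST k. \<exists>A. cospans Z S A \<and> card A = k)"

lemma corank_le: "cospans Z S A \<Longrightarrow> corank Z S \<le> card A"
  unfolding corank_def by (rule Least_le) blast

lemma corank_witness:
  assumes "cospans Z S A" obtains A' where "cospans Z S A'" "card A' = corank Z S"
proof -
  have "\<exists>A'. cospans Z S A' \<and> card A' = corank Z S"
    unfolding corank_def by (rule LeastI_ex) (use assms in blast)
  then show ?thesis using that by blast
qed

lemma corank_not_cospanned: "\<nexists>A. cospans Z S A \<Longrightarrow> corank Z S = (LEAST k. False)"
  unfolding corank_def by simp

lemma corank_cong_span:
  assumes "span S = span S'" shows "corank Z S = corank Z S'"
  unfolding corank_def cospans_def by (simp add: span_Un assms)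

lemma cospans_mono: "cospans Z S A \<Longrightarrow> S \<subseteq> S' \<Longrightarrow> cospans Z S' A"
  unfolding cospans_def by (meson Un_mono order_refl order_trans span_mono)

lemma cospans_Un:
  assumes "cospans Z (S \<union> D) A" "finite D" "D \<subseteq> Z" shows "cospans Z S (A \<union> D)"
  using assms by (auto simp: cospans_def Un_ac)

text \<open>Steinitz exchange: a smallest set cospanning \<open>S\<close> contains an element that
  \<open>z\<close> can replace. The finite cospanning set in the hypothesis keeps both coranks away
  from the default value.\<close>

lemma corank_insert:
  assumes z: "z \<in> Z" "z \<notin> span S" and fin: "cospans Z S A"
  shows "corank Z S = Suc (corank Z (insert z S))"
proof (rule antisym)
  obtain A where A: "cospans Z (insert z S) A" "card A = corank Z (insert z S)"
    using corank_witness[OF cospans_mono[OF fin subset_insertI]] .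
  have "cospans Z S (A \<union> {z})" using A(1) z(1) by (intro cospans_Un) auto
  then have "corank Z S \<le> card (A \<union> {z})" by (rule corank_le)
  also have "\<dots> \<le> Suc (card A)" using card_Un_le[of A "{z}"] by simp
  finally show "corank Z S \<le> Suc (corank Z (insert z S))" using A(2) by simp
next
  obtain A where A: "cospans Z S A" "card A = corank Z S" using corank_witness[OF fin] .
  have finA: "finite A" using A(1) by (simp add: cospans_def)
  \<comment> \<open>If no element could be exchanged for \<open>z\<close>, adjoining the elements of
    \<open>A\<close> to \<open>S\<close> one at a time would never put \<open>z\<close> into the
    span, although \<open>A \<union> S\<close> spans all of \<open>Z\<close>.\<close>
  have "\<exists>a B. a \<in> A \<and> B = A - {a} \<and> a \<in> span (insert z (B \<union> S))"
  proof (rule ccontr)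
    assume neg: "\<not> ?thesis"
    have "z \<notin> span (B \<union> S)" if "finite B" "B \<subseteq> A" for B
      using that
    proof (induction B rule: finite_induct)
      case empty then show ?case using z by simp
    next
      case (insert a B)
      show ?case
      proof
        assume "z \<in> span (insert a B \<union> S)"
        then have "a \<in> span (insert z (B \<union> S))"
          using in_span_insert[of z a "B \<union> S"] insert by auto
        moreover have "insert z (B \<union> S) \<subseteq> insert z (A - {a} \<union> S)"
          using insert by auto
        ultimately have "a \<in> span (insert z (A - {a} \<union> S))" using span_mono by blast
        then show False using neg insert.prems by blast
      qed
    qed
    then show False using A(1) z(1) finA by (auto simp: cospans_def)
  qed
  then obtain a where a: "a \<in> A" "a \<in> span (insert z (A - {a} \<union> S))" by blast
  have "span (A \<union> S) \<subseteq> span (A - {a} \<union> insert z S)"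
  proof (rule span_minimal)
    show "A \<union> S \<subseteq> span (A - {a} \<union> insert z S)"
    proof
      fix x assume "x \<in> A \<union> S"
      then consider "x = a" | "x \<in> A - {a} \<union> insert z S" by blast
      then show "x \<in> span (A - {a} \<union> insert z S)"
        using a(2) by cases (auto intro: span_base)
    qed
  qed simp
  then have "cospans Z (insert z S) (A - {a})" using A(1) by (auto simp: cospans_def)
  then have "corank Z (insert z S) \<le> card (A - {a})" by (rule corank_le)
  then show "Suc (corank Z (insert z S)) \<le> corank Z S"
    using A(2) finA a(1) by (metis Suc_le_mono card.remove)
qed

text \<open>Diminishing returns: adjoining \<open>z\<close> lowers the corank by 1 if
  \<open>z\<close> is outside the span and by 0 otherwise, and a vector outside the larger span is
  also outside the smaller one.\<close>

lemma corank_step: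
  assumes S': "S' = S \<union> D" "finite D" "D \<subseteq> Z" and z: "z \<in> Z"
  shows "corank Z (insert z S) + corank Z S' \<le> corank Z (insert z S') + corank Z S"
proof (cases "\<exists>A. cospans Z S A")
  case False
  \<comment> \<open>A finite cospanning set for a finite enlargement of \<open>S\<close>, together
    with the added vectors, would cospan \<open>S\<close>. So all four terms equal the same default
    value.\<close>
  have "\<nexists>A. cospans Z S'' A" if "S'' = S \<union> D''" "finite D''" "D'' \<subseteq> Z" for S'' D''
    using False cospans_Un that by blast
  from this[of S' D] this[of "insert z S" "{z}"] this[of "insert z S'" "insert z D"]
  show ?thesis using False S' z by (simp add: corank_not_cospanned)
next
  case True
  then obtain A where A: "cospans Z S A" by blast
  have A': "cospans Z S' A" using cospans_mono[OF A] S' by simp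
  have eq: "corank Z (insert z T) = corank Z T" if "z \<in> span T" for T
    by (rule corank_cong_span) (simp add: span_redundant that)
  show ?thesis
  proof (cases "z \<in> span S'")
    case True
    have "corank Z (insert z S) \<le> corank Z S"
      by (cases "z \<in> span S") (simp_all add: eq corank_insert[OF z _ A])
    then show ?thesis using eq[OF True] by simp
  next
    case False
    moreover have "z \<notin> span S" using False S' span_mono[of S S'] by auto
    ultimately show ?thesis using corank_insert[OF z _ A] corank_insert[OF z _ A'] by simp
  qed
qed

text \<open>The vectors of \<open>F - G\<close> are adjoined one at a time to both \<open>?I\<close>
  and the larger \<open>?H\<close>; each of them lowers the corank over \<open>?I\<close> by at
  least as much as over \<open>?H\<close>.\<close>

lemma corank_supermodular:
  assumes F: "finite F" and G: "finite G" and v: "v ` (F \<union> G) \<subseteq> Z"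
  shows "corank Z (S \<union> v ` F) + corank Z (S \<union> v ` G)
    \<le> corank Z (S \<union> v ` (F \<union> G)) + corank Z (S \<union> v ` (F \<inter> G))"
proof -
  let ?I = "S \<union> v ` (F \<inter> G)" and ?H = "S \<union> v ` G"
  have "corank Z (?I \<union> v ` D) + corank Z ?H \<le> corank Z (?H \<union> v ` D) + corank Z ?I"
    if "finite D" "D \<subseteq> F" for D
    using that
  proof (induction D rule: finite_induct)
    case (insert d D)
    have "corank Z (insert (v d) (?I \<union> v ` D)) + corank Z (?H \<union> v ` D)
        \<le> corank Z (insert (v d) (?H \<union> v ` D)) + corank Z (?I \<union> v ` D)"
      by (rule corank_step[of _ _ "v ` G"]) (use insert.prems G v in auto)
    with insert show ?case by simp
  qed simp
  from this[of "F - G"] F have "corank Z (?I \<union> v ` (F - G)) + corank Z ?H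
      \<le> corank Z (?H \<union> v ` (F - G)) + corank Z ?I" by blast
  moreover have "?I \<union> v ` (F - G) = S \<union> v ` F" "?H \<union> v ` (F - G) = S \<union> v ` (F \<union> G)" by auto
  ultimately show ?thesis by simp
qed

text \<open>Second isomorphism theorem: \<open>Z0\<close> modulo \<open>B \<inter> Z0\<close> is
  \<open>Z0 + B\<close> modulo \<open>B\<close>, and \<open>decomp\<close> says that
  \<open>Z0 + B\<close> contains \<open>Z\<close>. It moves the count of generators from a varying
  space of cycles to a fixed one.\<close>

lemma corank_restrict:
  assumes Z0: "subspace Z0" "Z0 \<subseteq> Z" and B: "subspace B"
    and decomp: "\<And>z. z \<in> Z \<Longrightarrow> \<exists>y\<in>Z0. z - y \<in> B"
  shows "corank Z B = corank Z0 (B \<inter> Z0)"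
  unfolding corank_def
proof (rule LEAST_eqI[symmetric])
  fix k assume "\<exists>A. cospans Z0 (B \<inter> Z0) A \<and> card A = k"
  then obtain A where A: "cospans Z0 (B \<inter> Z0) A" "card A = k" by blast
  have "Z \<subseteq> span (A \<union> B)"
  proof
    fix z assume "z \<in> Z"
    then obtain y where y: "y \<in> Z0" "z - y \<in> B" using decomp by blast
    then have "y \<in> span (A \<union> B)"
      using A(1) span_mono[of "A \<union> B \<inter> Z0" "A \<union> B"] by (auto simp: cospans_def)
    then have "y + (z - y) \<in> span (A \<union> B)" using y(2) by (intro span_add) (auto intro: span_base)
    then show "z \<in> span (A \<union> B)" by simp
  qed
  then show "\<exists>A. cospans Z B A \<and> card A = k"
    using A Z0(2) by (auto simp: cospans_def)
next
  fix k assume "\<exists>A. cospans Z B A \<and> card A = k"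
  then obtain A where A: "finite A" "A \<subseteq> Z" "Z \<subseteq> span (A \<union> B)" "card A = k"
    by (auto simp: cospans_def)
  \<comment> \<open>Each generator is replaced by a representative in \<open>Z0\<close>.
    Representatives may coincide, so only a bound on the size is obtained.\<close>
  obtain p where p: "\<And>a. a \<in> A \<Longrightarrow> p a \<in> Z0 \<and> a - p a \<in> B"
    using A(2) decomp by (metis subsetD)
  have "a \<in> span (p ` A \<union> B)" if "a \<in> A" for a
  proof -
    have "p a + (a - p a) \<in> span (p ` A \<union> B)"
      using p[OF that] that by (intro span_add) (auto intro: span_base)
    then show ?thesis by simp
  qed
  then have "A \<union> B \<subseteq> span (p ` A \<union> B)" by (auto intro: span_base)
  then have AB: "span (A \<union> B) \<subseteq> span (p ` A \<union> B)" by (simp add: span_minimal)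
  have "Z0 \<subseteq> span (p ` A \<union> B \<inter> Z0)"
  proof
    fix x assume x: "x \<in> Z0"
    then have "x \<in> span (p ` A \<union> B)" using AB A(3) Z0(2) by blast
    \<comment> \<open>Modular law: \<open>x\<close> and \<open>u\<close> lie in \<open>Z0\<close>,
      hence so does the component \<open>v\<close> in \<open>B\<close>.\<close>
    then obtain u v where uv: "x = u + v" "u \<in> span (p ` A)" "v \<in> B"
      using span_eq_iff[THEN iffD2, OF B] unfolding span_Un by auto
    have "u \<in> Z0" using uv(2) p span_minimal[of "p ` A" Z0] Z0(1) by auto
    then have "v \<in> Z0" using subspace_diff[OF Z0(1) x, of u] uv(1) by simp
    moreover have "u \<in> span (p ` A \<union> B \<inter> Z0)" using uv(2) span_mono[of "p ` A"] by blast
    ultimately show "x \<in> span (p ` A \<union> B \<inter> Z0)"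
      unfolding uv(1) using uv(3) by (intro span_add) (auto intro: span_base)
  qed
  then have "cospans Z0 (B \<inter> Z0) (p ` A)" using p A(1) by (auto simp: cospans_def)
  then show "\<exists>j\<le>k. \<exists>A. cospans Z0 (B \<inter> Z0) A \<and> card A = j"
    using card_image_le[OF A(1), of p] A(4) by blast
qed

end

section \<open>Chains with field coefficients\<close>

abbreviation fscale :: "'k::field \<Rightarrow> ('b \<Rightarrow>\<^sub>0 'k) \<Rightarrow> 'b \<Rightarrow>\<^sub>0 'k"
  where "fscale r \<equiv> Poly_Mapping.map ((*) r)"

lemma lookup_fscale [simp]: "Poly_Mapping.lookup (fscale r c) x = r * Poly_Mapping.lookup c x"
  by (simp add: Poly_Mapping.map.rep_eq when_def)

interpretation fchain: coranked_space "fscale :: 'k::field \<Rightarrow> ('b \<Rightarrow>\<^sub>0 'k) \<Rightarrow> 'b \<Rightarrow>\<^sub>0 'k"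
  by unfold_locales (auto intro!: poly_mapping_eqI simp: lookup_add algebra_simps)

definition of_frag :: "('b \<Rightarrow>\<^sub>0 int) \<Rightarrow> 'b \<Rightarrow>\<^sub>0 'k::field"
  where "of_frag = Poly_Mapping.map of_int"

lemma lookup_of_frag [simp]: "Poly_Mapping.lookup (of_frag c) x = of_int (Poly_Mapping.lookup c x)"
  by (simp add: of_frag_def Poly_Mapping.map.rep_eq when_def)

lemma of_frag_simps [simp]:
  "of_frag 0 = 0" "of_frag (a + b) = of_frag a + of_frag b" "of_frag (a - b) = of_frag a - of_frag b"
  "of_frag (frag_cmul k a) = fscale (of_int k) (of_frag a)"
  by (auto intro!: poly_mapping_eqI simp: lookup_add lookup_minus)

lemma of_frag_sum: "of_frag (sum f I) = (\<Sum>i\<in>I. of_frag (f i))"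
  by (induction I rule: infinite_finite_induct) auto

lemma keys_of_frag: "Poly_Mapping.keys (of_frag c) \<subseteq> Poly_Mapping.keys c"
  by (auto simp: in_keys_iff)

text \<open>The map \<open>f\<close> tensored with the field. Keeping \<open>f\<close> integral lets
  identities between integral chain maps pass to the field through \<open>fextend_of_frag\<close>
  and \<open>fextend_fextend\<close>.\<close>

definition fextend :: "('b \<Rightarrow> 'c \<Rightarrow>\<^sub>0 int) \<Rightarrow> ('b \<Rightarrow>\<^sub>0 'k::field) \<Rightarrow> 'c \<Rightarrow>\<^sub>0 'k"
  where "fextend f c = (\<Sum>x\<in>Poly_Mapping.keys c. fscale (Poly_Mapping.lookup c x) (of_frag (f x)))"

lemma fextend_superset:
  assumes "finite S" "Poly_Mapping.keys c \<subseteq> S"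
  shows "fextend f c = (\<Sum>x\<in>S. fscale (Poly_Mapping.lookup c x) (of_frag (f x)))"
  unfolding fextend_def
  by (rule sum.mono_neutral_left) (use assms in \<open>auto simp: in_keys_iff\<close>)

lemma fextend_add: "fextend f (a + b) = fextend f a + fextend f b"
proof -
  let ?S = "Poly_Mapping.keys a \<union> Poly_Mapping.keys b"
  have "fextend f c = (\<Sum>x\<in>?S. fscale (Poly_Mapping.lookup c x) (of_frag (f x)))"
    if "c \<in> {a, b, a + b}" for c
    by (rule fextend_superset) (use that keys_add[of a b] in auto)
  then show ?thesis
    by (simp add: lookup_add fchain.scale_left_distrib sum.distrib)
qed

lemma fextend_scale: "fextend f (fscale r c) = fscale r (fextend f c)"
proof -
  have "fextend f (fscale r c)
    = (\<Sum>x\<in>Poly_Mapping.keys c. fscale (Poly_Mapping.lookup (fscale r c) x) (of_frag (f x)))"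
    by (rule fextend_superset) (auto simp: in_keys_iff)
  then show ?thesis by (simp add: fextend_def fchain.scale_sum_right)
qed

lemma fextend_0 [simp]: "fextend f 0 = 0"
  by (simp add: fextend_def)

lemma fextend_diff: "fextend f (a - b) = fextend f a - fextend f b"
  using fextend_add[of f "a - b" b] by (simp add: algebra_simps)

lemma fextend_sum: "fextend f (sum g I) = (\<Sum>i\<in>I. fextend f (g i))"
  by (induction I rule: infinite_finite_induct) (auto simp: fextend_add)

lemma fextend_of_frag: "fextend f (of_frag c :: 'b \<Rightarrow>\<^sub>0 'k::field) = of_frag (frag_extend f c)"
proof -
  have "fextend f (of_frag c :: 'b \<Rightarrow>\<^sub>0 'k)
    = (\<Sum>x\<in>Poly_Mapping.keys c. fscale (Poly_Mapping.lookup (of_frag c) x) (of_frag (f x)))"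
    by (rule fextend_superset) (use keys_of_frag[of c] in auto)
  then show ?thesis by (simp add: frag_extend_def of_frag_sum)
qed

lemma fextend_fextend: "fextend f (fextend g c) = fextend (\<lambda>x. frag_extend f (g x)) c"
  by (simp add: fextend_def[of g] fextend_sum fextend_scale fextend_of_frag)
    (simp add: fextend_def)

lemma fextend_diff_fun: "fextend (\<lambda>x. f x - g x) c = fextend f c - fextend g c"
  by (simp add: fextend_def fchain.scale_right_diff_distrib sum_subtractf)

lemma fextend_frag_of [simp]: "fextend frag_of c = c"
proof (rule poly_mapping_eqI)
  fix x
  show "Poly_Mapping.lookup (fextend frag_of c) x = Poly_Mapping.lookup c x"
    by (simp add: fextend_def lookup_sum in_keys_iff when_def if_distrib
        sum.delta cong: if_cong)
qed

section \<open>The singular chain complex over a field as a scalar extension\<close>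

lemma field_chains_subspace: "fchain.subspace (field_chains n T)"
proof (rule fchain.subspaceI)
  show "a + b \<in> field_chains n T" if "a \<in> field_chains n T" "b \<in> field_chains n T" for a b
    using that keys_add[of a b] by (auto simp: field_chains_def)
  show "fscale r a \<in> field_chains n T" if "a \<in> field_chains n T" for r a
    using that by (auto simp: field_chains_def in_keys_iff subset_iff)
qed (simp add: field_chains_def)

lemmas field_chains_closed =
  fchain.subspace_0[OF field_chains_subspace] fchain.subspace_add[OF field_chains_subspace]
  fchain.subspace_diff[OF field_chains_subspace] fchain.subspace_scale[OF field_chains_subspace]

lemma of_frag_in_field_chains: "singular_chain n T c \<Longrightarrow> of_frag c \<in> field_chains n T"
  using keys_of_frag[of c] by (auto simp: field_chains_def singular_chain_def)

lemma fextend_in_field_chains: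
  assumes "\<And>\<sigma>. \<sigma> \<in> Poly_Mapping.keys c \<Longrightarrow> singular_chain n T (f \<sigma>)"
  shows "fextend f c \<in> field_chains n T"
  unfolding fextend_def
  by (intro fchain.subspace_sum field_chains_subspace field_chains_closed of_frag_in_field_chains assms)

lemma field_chains_mono:
  "S \<subseteq> S' \<Longrightarrow> field_chains n (subtopology T S) \<subseteq> field_chains n (subtopology T S')"
  unfolding field_chains_def by (blast intro: singular_simplex_mono)

text \<open>With the boundary recognised as the extension of the integral one, its linearity and the
  vanishing of its square follow from the calculus of \<open>fextend\<close>.\<close>

lemma field_boundary_eq_fextend:
  "field_boundary n c = fextend (\<lambda>\<sigma>. chain_boundary n (frag_of \<sigma>)) c"
proof (cases "n = 0")
  case False
  have "fscale r (of_frag (chain_boundary n (frag_of \<sigma>)))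
    = (\<Sum>k\<le>n. Poly_Mapping.single (singular_face n k \<sigma>) ((- 1) ^ k * r))"
    for r :: 'b and \<sigma> :: "(nat \<Rightarrow> real) \<Rightarrow> 'a"
  proof (rule poly_mapping_eqI)
    fix x
    have "r * (of_int ((- 1) ^ k) * of_int (Poly_Mapping.lookup (frag_of (singular_face n k \<sigma>)) x))
      = Poly_Mapping.lookup (Poly_Mapping.single (singular_face n k \<sigma>) ((- 1) ^ k * r)) x" for k
      by (simp add: lookup_single when_def)
    then show "Poly_Mapping.lookup (fscale r (of_frag (chain_boundary n (frag_of \<sigma>)))) x
      = Poly_Mapping.lookup (\<Sum>k\<le>n. Poly_Mapping.single (singular_face n k \<sigma>) ((- 1) ^ k * r)) x"
      using False by (simp add: chain_boundary_of lookup_sum sum_distrib_left)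
  qed
  then show ?thesis using False by (simp add: field_boundary_def fextend_def)
qed (simp add: field_boundary_def fextend_def chain_boundary_of)

lemma field_boundary_linear:
  "field_boundary n 0 = 0"
  "field_boundary n (a + b) = field_boundary n a + field_boundary n b"
  "field_boundary n (a - b) = field_boundary n a - field_boundary n b"
  "field_boundary n (fscale r a) = fscale r (field_boundary n a)"
  by (simp_all add: field_boundary_eq_fextend fextend_add fextend_diff fextend_scale)

lemma frag_extend_chain_boundary:
  "frag_extend (\<lambda>\<sigma>. chain_boundary n (frag_of \<sigma>)) c = chain_boundary n c"
  using subset_UNIV[of "Poly_Mapping.keys c"]
  by (induction c rule: frag_induction) (auto simp: frag_extend_diff chain_boundary_diff)

lemma field_boundary_of_frag: "field_boundary n (of_frag c) = of_frag (chain_boundary n c)"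
  by (simp add: field_boundary_eq_fextend fextend_of_frag frag_extend_chain_boundary)

lemma field_boundary_in_field_chains:
  assumes "c \<in> field_chains n T" shows "field_boundary n c \<in> field_chains (n - 1) T"
  unfolding field_boundary_eq_fextend
proof (rule fextend_in_field_chains)
  fix \<sigma> assume "\<sigma> \<in> Poly_Mapping.keys c"
  then have "singular_chain n T (frag_of \<sigma>)"
    using assms by (auto simp: field_chains_def singular_chain_of)
  then show "singular_chain (n - 1) T (chain_boundary n (frag_of \<sigma>))"
    using singular_chain_boundary by fastforce
qed

lemma field_boundary_boundary:
  assumes "c \<in> field_chains (Suc n) T" shows "field_boundary n (field_boundary (Suc n) c) = 0"
proof -
  have "chain_boundary n (chain_boundary (Suc n) (frag_of \<sigma>)) = 0" if "\<sigma> \<in> Poly_Mapping.keys c" for \<sigma>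
    using that assms
    by (intro chain_boundary_boundary_alt) (auto simp: field_chains_def singular_chain_of)
  then show ?thesis
    unfolding field_boundary_eq_fextend fextend_fextend frag_extend_chain_boundary
    by (simp add: fextend_def)
qed

section \<open>Partial contractions and relative cycles over the field\<close>

text \<open>The usual construction of a contracting homotopy on a free complex, one degree at a
  time, stopped where acyclicity ends. Writing d for the boundary, the operator 1 - s d then maps
  \<open>m\<close>-chains to relative cycles; \<open>s\<close> also preserves chains of the
  subspace.\<close>

lemma acyclic_below_imp_partial_contraction:
  assumes "\<And>k c. k < m \<Longrightarrow> singular_relcycle k T S c \<Longrightarrow> singular_relboundary k T S c"
  shows "\<exists>s. (\<forall>\<sigma>. singular_simplex (m - 1) T \<sigma> \<longrightarrow> singular_chain m T (s \<sigma>))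
    \<and> (\<forall>\<sigma>. singular_simplex (m - 1) (subtopology T S) \<sigma> \<longrightarrow> singular_chain m (subtopology T S) (s \<sigma>))
    \<and> (\<forall>c. singular_chain m T c \<longrightarrow> singular_relcycle m T S (c - frag_extend s (chain_boundary m c)))"
  using assms
proof (induction m)
  case 0
  \<comment> \<open>Every chain of degree 0 has zero boundary, so it is a relative cycle and the
    zero map serves as \<open>s\<close>.\<close>
  show ?case
    by (intro exI[of _ "\<lambda>_. 0"])
      (auto simp: singular_relcycle chain_boundary_def frag_extend_def)
next
  case (Suc m)
  obtain s where s: "\<And>\<sigma>. singular_simplex (m - 1) T \<sigma> \<Longrightarrow> singular_chain m T (s \<sigma>)"
    and sS: "\<And>\<sigma>. singular_simplex (m - 1) (subtopology T S) \<sigma> \<Longrightarrow> singular_chain m (subtopology T S) (s \<sigma>)"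
    and rel: "\<And>c. singular_chain m T c \<Longrightarrow> singular_relcycle m T S (c - frag_extend s (chain_boundary m c))"
    using Suc by (metis less_Suc_eq)
  define r where "r = (\<lambda>c. c - frag_extend s (chain_boundary m c))"
  have r_diff: "r (a - b) = r a - r b" for a b
    by (simp add: r_def chain_boundary_diff frag_extend_diff)
  have rS: "singular_chain m (subtopology T S) (r (frag_of \<sigma>))"
    if "singular_simplex m (subtopology T S) \<sigma>" for \<sigma>
  proof -
    have *: "singular_chain m (subtopology T S) (frag_of \<sigma>)" using that by (simp add: singular_chain_of)
    have "singular_chain m (subtopology T S) (frag_extend s (chain_boundary m (frag_of \<sigma>)))"
      using singular_chain_boundary[OF *]
      by (intro singular_chain_extend sS) (auto simp: singular_chain_def)
    with * show ?thesis by (simp add: r_def singular_chain_diff)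
  qed
  \<comment> \<open>The relative cycle \<open>r (frag_of \<sigma>)\<close> is filled using
    acyclicity in degree \<open>m\<close>. On simplices of the subspace \<open>rS\<close> allows the
    filling 0, which makes the new map preserve the subspace.\<close>
  have "\<exists>d. singular_chain (Suc m) T d \<and> (singular_simplex m (subtopology T S) \<sigma> \<longrightarrow> d = 0) \<and>
      singular_chain m (subtopology T S) (chain_boundary (Suc m) d - r (frag_of \<sigma>))"
    if \<sigma>: "singular_simplex m T \<sigma>" for \<sigma>
  proof (cases "singular_simplex m (subtopology T S) \<sigma>")
    case True
    then show ?thesis using rS[OF True] by (auto simp: singular_chain_minus)
  next
    case False
    have "singular_relboundary m T S (r (frag_of \<sigma>))"
      using Suc.prems[OF lessI] rel \<sigma> by (simp add: r_def singular_chain_of)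
    then show ?thesis using False by (auto simp: singular_relboundary_def mod_subset_def)
  qed
  then obtain s' where s': "\<And>\<sigma>. singular_simplex m T \<sigma> \<Longrightarrow> singular_chain (Suc m) T (s' \<sigma>)"
    "\<And>\<sigma>. singular_simplex m T \<sigma> \<Longrightarrow> singular_simplex m (subtopology T S) \<sigma> \<Longrightarrow> s' \<sigma> = 0"
    "\<And>\<sigma>. singular_simplex m T \<sigma> \<Longrightarrow> singular_chain m (subtopology T S) (chain_boundary (Suc m) (s' \<sigma>) - r (frag_of \<sigma>))"
    by metis
  have ext: "singular_chain (Suc m) T (frag_extend s' e)" if "singular_chain m T e" for e
    using that s'(1) by (intro singular_chain_extend) (auto simp: singular_chain_def)
  have rel': "singular_chain m (subtopology T S) (chain_boundary (Suc m) (frag_extend s' e) - r e)"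
    if e: "singular_chain m T e" for e
    using e unfolding singular_chain_def[of m T]
  proof (induction e rule: frag_induction)
    case zero then show ?case by (simp add: r_def)
  next
    case (one \<sigma>) then show ?case using s'(3) by simp
  next
    case (diff a b)
    have "chain_boundary (Suc m) (frag_extend s' (a - b)) - r (a - b)
      = (chain_boundary (Suc m) (frag_extend s' a) - r a) - (chain_boundary (Suc m) (frag_extend s' b) - r b)"
      by (simp add: frag_extend_diff chain_boundary_diff r_diff)
    with diff show ?case by (simp add: singular_chain_diff)
  qed
  have "singular_relcycle (Suc m) T S (c - frag_extend s' (chain_boundary (Suc m) c))"
    if c: "singular_chain (Suc m) T c" for c
  proof -
    have dc: "singular_chain m T (chain_boundary (Suc m) c)" using singular_chain_boundary_alt[OF c] .
    \<comment> \<open>Because the boundary of a boundary vanishes, \<open>r\<close> fixes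
      boundaries. By \<open>rel'\<close>, the boundary of \<open>c\<close> then agrees with that of
      \<open>frag_extend s' (chain_boundary (Suc m) c)\<close> modulo the subspace.\<close>
    have "r (chain_boundary (Suc m) c) = chain_boundary (Suc m) c"
      by (simp add: r_def chain_boundary_boundary_alt[OF c])
    then have "singular_chain m (subtopology T S)
        (- (chain_boundary (Suc m) c - chain_boundary (Suc m) (frag_extend s' (chain_boundary (Suc m) c))))"
      using rel'[OF dc] by simp
    then show ?thesis
      using c ext[OF dc] unfolding singular_chain_minus
      by (simp add: singular_relcycle chain_boundary_diff singular_chain_diff)
  qed
  then show ?case
    using s' by (intro exI[of _ s']) (auto simp: singular_simplex_subtopology)
qed

text \<open>With the contraction \<open>s\<close> and the boundary d, split z as (1 - s d) z + s d
  z, extended linearly over the field. The first term combines integral relative cycles, one for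
  each simplex of \<open>z\<close>; the second lies in the subspace because d z does and
  \<open>s\<close> preserves it.\<close>

lemma field_relcycle_decompose:
  assumes acyclic: "\<And>k c. k < m \<Longrightarrow> singular_relcycle k T S c \<Longrightarrow> singular_relboundary k T S c"
    and z: "z \<in> field_chains m T" and dz: "field_boundary m z \<in> field_chains (m - 1) (subtopology T S)"
  obtains a b where "z = a + b" "a \<in> fchain.span (of_frag ` singular_relcycle_set m T S)"
    "b \<in> field_chains m (subtopology T S)"
proof -
  obtain s where
    sS: "\<And>\<sigma>. singular_simplex (m - 1) (subtopology T S) \<sigma> \<Longrightarrow> singular_chain m (subtopology T S) (s \<sigma>)"
    and rel: "\<And>c. singular_chain m T c \<Longrightarrow> singular_relcycle m T S (c - frag_extend s (chain_boundary m c))"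
    using acyclic_below_imp_partial_contraction[of m T S] acyclic by blast
  let ?r = "\<lambda>\<sigma>. frag_of \<sigma> - frag_extend s (chain_boundary m (frag_of \<sigma>))"
  have "fextend ?r z = z - fextend s (field_boundary m z)"
    by (simp add: fextend_diff_fun field_boundary_eq_fextend fextend_fextend)
  then have "z = fextend ?r z + fextend s (field_boundary m z)" by simp
  moreover have "fextend ?r z \<in> fchain.span (of_frag ` singular_relcycle_set m T S)"
    unfolding fextend_def
    by (intro fchain.span_sum fchain.span_scale fchain.span_base imageI CollectI rel)
      (use z in \<open>auto simp: field_chains_def singular_chain_of\<close>)
  moreover have "fextend s (field_boundary m z) \<in> field_chains m (subtopology T S)"
    by (rule fextend_in_field_chains, rule sS) (use dz in \<open>auto simp: field_chains_def\<close>)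
  ultimately show ?thesis using that by blast
qed

section \<open>Betti numbers as codimensions\<close>

lemma field_boundaries_subspace: "fchain.subspace (field_boundaries n T)"
proof (rule fchain.subspaceI)
  show "0 \<in> field_boundaries n T"
    unfolding field_boundaries_def by (rule image_eqI[of _ _ 0]) (simp_all add: field_boundary_linear field_chains_closed)
  show "a + b \<in> field_boundaries n T" if "a \<in> field_boundaries n T" "b \<in> field_boundaries n T" for a b
    using that unfolding field_boundaries_def
    by (auto simp: field_chains_closed simp flip: field_boundary_linear)
  show "fscale r a \<in> field_boundaries n T" if "a \<in> field_boundaries n T" for r a
    using that unfolding field_boundaries_def
    by (auto simp: field_chains_closed simp flip: field_boundary_linear)
qed

lemma field_cycles_subspace: "fchain.subspace (field_cycles n T)"
  by (rule fchain.subspaceI) (auto simp: field_cycles_def field_boundary_linear field_chains_closed)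

lemma field_boundaries_subset_cycles: "field_boundaries n T \<subseteq> field_cycles n T"
  using field_boundary_in_field_chains[of _ "Suc n" T]
  by (auto simp: field_boundaries_def field_cycles_def field_boundary_boundary)

lemmas field_boundaries_closed =
  fchain.subspace_0[OF field_boundaries_subspace] fchain.subspace_add[OF field_boundaries_subspace]
  fchain.subspace_neg[OF field_boundaries_subspace] fchain.subspace_scale[OF field_boundaries_subspace]

lemmas field_cycles_closed =
  fchain.subspace_0[OF field_cycles_subspace] fchain.subspace_add[OF field_cycles_subspace]
  fchain.subspace_neg[OF field_cycles_subspace] fchain.subspace_scale[OF field_cycles_subspace]

lemma homology_class_eq_iff:
  "homology_class n T y = homology_class n T z \<longleftrightarrow> y - z \<in> field_boundaries n T"
proof
  assume "homology_class n T y = homology_class n T z"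
  moreover have "y \<in> homology_class n T y"
    unfolding homology_class_def
    by (rule image_eqI[of _ _ 0]) (simp_all add: field_boundaries_closed)
  ultimately show "y - z \<in> field_boundaries n T" by (auto simp: homology_class_def)
next
  have *: "homology_class n T y \<subseteq> homology_class n T z" if "y - z \<in> field_boundaries n T" for y z :: "('a, 'b) field_chain"
  proof
    fix x assume "x \<in> homology_class n T y"
    then obtain b where b: "b \<in> field_boundaries n T" "x = y + b" by (auto simp: homology_class_def)
    then have "x = z + (y - z + b)" "y - z + b \<in> field_boundaries n T"
      using that by (simp_all add: fchain.subspace_add[OF field_boundaries_subspace])
    then show "x \<in> homology_class n T z" unfolding homology_class_def by blast
  qed
  assume "y - z \<in> field_boundaries n T"
  moreover from this have "z - y \<in> field_boundaries n T"
    using fchain.subspace_neg[OF field_boundaries_subspace] by fastforce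
  ultimately show "homology_class n T y = homology_class n T z" using * by blast
qed

lemma homology_class_iff: "x \<in> homology_class n T z \<longleftrightarrow> x - z \<in> field_boundaries n T"
  unfolding homology_class_def by (auto intro: image_eqI[of _ _ "x - z"])

lemma homology_class_add:
  "{a + b | a b. a \<in> homology_class n T y \<and> b \<in> homology_class n T z} = homology_class n T (y + z)"
proof (intro equalityI subsetI)
  fix x assume "x \<in> {a + b | a b. a \<in> homology_class n T y \<and> b \<in> homology_class n T z}"
  then obtain a b where "x = a + b" "a - y \<in> field_boundaries n T" "b - z \<in> field_boundaries n T"
    by (auto simp: homology_class_iff)
  then show "x \<in> homology_class n T (y + z)"
    using fchain.subspace_add[OF field_boundaries_subspace, of "a - y" n T "b - z"]
    by (simp add: homology_class_iff add_diff_add)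
next
  fix x assume "x \<in> homology_class n T (y + z)"
  then have "y \<in> homology_class n T y" "x - y \<in> homology_class n T z" "x = y + (x - y)"
    by (simp_all add: homology_class_iff field_boundaries_closed diff_diff_eq)
  then show "x \<in> {a + b | a b. a \<in> homology_class n T y \<and> b \<in> homology_class n T z}" by blast
qed

lemma homology_class_scale:
  "{fscale r a + b | a b. a \<in> homology_class n T z \<and> b \<in> field_boundaries n T} = homology_class n T (fscale r z)"
proof (intro equalityI subsetI)
  fix x assume "x \<in> {fscale r a + b | a b. a \<in> homology_class n T z \<and> b \<in> field_boundaries n T}"
  then obtain a b where x: "x = fscale r a + b" "a - z \<in> field_boundaries n T" "b \<in> field_boundaries n T"
    by (auto simp: homology_class_iff)
  have "x - fscale r z = fscale r (a - z) + b"
    using x(1) by (simp add: fchain.scale_right_diff_distrib)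
  then show "x \<in> homology_class n T (fscale r z)"
    using x(2,3) by (simp add: homology_class_iff field_boundaries_closed)
next
  fix x assume "x \<in> homology_class n T (fscale r z)"
  then have "z \<in> homology_class n T z" "x - fscale r z \<in> field_boundaries n T"
    "x = fscale r z + (x - fscale r z)"
    by (simp_all add: homology_class_iff field_boundaries_closed)
  then show "x \<in> {fscale r a + b | a b. a \<in> homology_class n T z \<and> b \<in> field_boundaries n T}" by blast
qed

section \<open>Homology as a vector space and its generating sets\<close>

lemma homology_class_0: "homology_class n T 0 = field_boundaries n T"
  by (simp add: homology_class_def)

lemma field_homology_simps:
  "carrier (field_homology n T) = homology_class n T ` field_cycles n T"
  "\<zero>\<^bsub>field_homology n T\<^esub> = homology_class n T 0"
  "homology_class n T y \<oplus>\<^bsub>field_homology n T\<^esub> homology_class n T z = homology_class n T (y + z)"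
  "r \<odot>\<^bsub>field_homology n T\<^esub> homology_class n T z = homology_class n T (fscale r z)"
  by (simp_all add: field_homology_def homology_class_0 homology_class_add homology_class_scale)

lemma vectorspace_field_homology:
  "vectorspace (class_ring :: 'k::field ring) (field_homology n T :: ('k, ('a, 'k) field_chain set) module)"
proof -
  let ?V = "field_homology n T :: ('k, ('a, 'k) field_chain set) module"
  have "abelian_group ?V"
  proof (rule abelian_groupI)
    show "\<exists>y\<in>carrier ?V. y \<oplus>\<^bsub>?V\<^esub> x = \<zero>\<^bsub>?V\<^esub>" if "x \<in> carrier ?V" for x
    proof -
      from that obtain z where z: "z \<in> field_cycles n T" "x = homology_class n T z"
        by (auto simp: field_homology_simps)
      then have "homology_class n T (- z) \<oplus>\<^bsub>?V\<^esub> x = \<zero>\<^bsub>?V\<^esub>" by (simp add: field_homology_simps)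
      then show ?thesis using z(1) by (auto simp: field_homology_simps field_cycles_closed)
    qed
  qed (auto simp: field_homology_simps field_cycles_closed ac_simps)
  moreover have "module_axioms (class_ring :: 'k ring) ?V"
    by unfold_locales
      (auto simp: field_homology_simps field_cycles_closed fchain.scale_left_distrib fchain.scale_right_distrib)
  moreover have "Ring.field (class_ring :: 'k ring)" by (rule class_field.field_axioms)
  ultimately show ?thesis
    by (simp add: vectorspace_def Module.module_def class_cring.cring_axioms)
qed

text \<open>Links spans in the carrier-based quotient to spans of chains. One direction pushes the
  span of chains forward to a submodule, the other pulls the span of classes back to a subspace;
  minimality of spans does the rest.\<close>

lemma homology_gen_set_iff:
  fixes A :: "('a, 'k::field) field_chain set"
  assumes A: "A \<subseteq> field_cycles n T"
  shows "LinearCombinations.module.span (class_ring :: 'k ring) (field_homology n T) (homology_class n T ` A)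
      = carrier (field_homology n T)
    \<longleftrightarrow> field_cycles n T \<subseteq> fchain.span (A \<union> field_boundaries n T)"
proof -
  let ?V = "field_homology n T :: ('k, ('a, 'k) field_chain set) module"
  let ?S = "fchain.span (A \<union> field_boundaries n T)"
  interpret V: vectorspace "class_ring :: 'k ring" ?V by (rule vectorspace_field_homology)
  have inC: "homology_class n T ` A \<subseteq> carrier ?V" using A by (auto simp: field_homology_simps)
  have SZ: "?S \<subseteq> field_cycles n T"
    using A field_boundaries_subset_cycles by (intro fchain.span_minimal field_cycles_subspace) auto
  have sub: "submodule (class_ring :: 'k ring) (V.span (homology_class n T ` A)) ?V"
    using V.span_is_submodule[OF inC] .
  show ?thesis
  proof
    assume gen: "V.span (homology_class n T ` A) = carrier ?V"
    have "submodule (class_ring :: 'k ring) (homology_class n T ` ?S) ?V"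
    proof (rule submodule.intro)
      show "Module.module (class_ring :: 'k ring) ?V" by unfold_locales
      show "homology_class n T ` ?S \<subseteq> carrier ?V" using SZ by (auto simp: field_homology_simps)
    qed (auto simp: field_homology_simps fchain.span_add fchain.span_scale fchain.span_zero)
    moreover have "homology_class n T ` A \<subseteq> homology_class n T ` ?S"
      by (auto intro: fchain.span_base)
    ultimately have "carrier ?V \<subseteq> homology_class n T ` ?S"
      using V.span_is_subset gen by blast
    show "field_cycles n T \<subseteq> ?S"
    proof
      fix z :: "('a, 'k) field_chain" assume "z \<in> field_cycles n T"
      then have "homology_class n T z \<in> homology_class n T ` ?S"
        using \<open>carrier ?V \<subseteq> _\<close> by (auto simp: field_homology_simps)
      then obtain s where s: "s \<in> ?S" "z - s \<in> field_boundaries n T"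
        by (auto simp: homology_class_eq_iff)
      then have "s + (z - s) \<in> ?S" by (intro fchain.span_add) (auto intro: fchain.span_base)
      then show "z \<in> ?S" by simp
    qed
  next
    assume gen: "field_cycles n T \<subseteq> ?S"
    let ?W = "{z \<in> field_cycles n T. homology_class n T z \<in> V.span (homology_class n T ` A)}"
    have "fchain.subspace ?W"
    proof (rule fchain.subspaceI)
      show "0 \<in> ?W"
        using submodule.zero_closed[OF sub] by (simp add: field_homology_simps field_cycles_closed)
      show "x + y \<in> ?W" if "x \<in> ?W" "y \<in> ?W" for x y
        using that submodule.m_closed[OF sub, of "homology_class n T x" "homology_class n T y"]
        by (simp add: field_homology_simps field_cycles_closed)
      show "fscale r x \<in> ?W" if "x \<in> ?W" for r x
        using that submodule.smult_closed[OF sub, of r "homology_class n T x"]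
        by (simp add: field_homology_simps field_cycles_closed)
    qed
    moreover have "A \<union> field_boundaries n T \<subseteq> ?W"
    proof -
      have "homology_class n T b = homology_class n T 0" if "b \<in> field_boundaries n T" for b :: "('a, 'k) field_chain"
        using that by (simp add: homology_class_eq_iff)
      then show ?thesis
        using V.in_own_span[OF inC] A submodule.zero_closed[OF sub]
        by (auto simp: field_homology_simps intro: subsetD[OF field_boundaries_subset_cycles])
    qed
    ultimately have "field_cycles n T \<subseteq> ?W" using gen fchain.span_minimal by blast
    then have "carrier ?V \<subseteq> V.span (homology_class n T ` A)" by (auto simp: field_homology_simps)
    then show "V.span (homology_class n T ` A) = carrier ?V"
      using V.span_is_subset2[OF inC] by blast
  qed
qed

lemma betti_eq_corank:
  "betti TYPE('k::field) n T
    = fchain.corank (field_cycles n T :: ('a, 'k) field_chain set) (field_boundaries n T)"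
proof -
  let ?V = "field_homology n T :: ('k, ('a, 'k) field_chain set) module"
  let ?Z = "field_cycles n T :: ('a, 'k) field_chain set"
  let ?B = "field_boundaries n T :: ('a, 'k) field_chain set"
  interpret V: vectorspace "class_ring :: 'k ring" ?V by (rule vectorspace_field_homology)
  let ?P = "\<lambda>k. \<exists>\<A>. finite \<A> \<and> card \<A> = k \<and> \<A> \<subseteq> carrier ?V \<and> V.span \<A> = carrier ?V"
  let ?Q = "\<lambda>k. \<exists>A. fchain.cospans ?Z ?B A \<and> card A = k"
  have "(LEAST k. ?P k) = (LEAST k. ?Q k)"
  proof (rule LEAST_eqI)
    fix k assume "?P k"
    then obtain \<A> where \<A>: "finite \<A>" "card \<A> = k" "\<A> \<subseteq> homology_class n T ` ?Z" "V.span \<A> = carrier ?V"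
      by (auto simp: field_homology_simps)
    \<comment> \<open>A choice of one cycle in each class is injective, so this direction keeps the
      size exactly.\<close>
    define A where "A = inv_into ?Z (homology_class n T) ` \<A>"
    have A: "A \<subseteq> ?Z" using \<A>(3) by (auto simp: A_def inv_into_into)
    have \<A>_eq: "homology_class n T ` A = \<A>"
        unfolding A_def by (rule image_inv_into_cancel[OF refl \<A>(3)])
    have "card A = k"
      using card_image[OF inj_on_inv_into[OF \<A>(3)]] \<A>(2) by (simp add: A_def)
    moreover have "finite A" using \<A>(1) by (simp add: A_def)
    moreover have "?Z \<subseteq> fchain.span (A \<union> ?B)"
      using homology_gen_set_iff[OF A] \<A>(4) \<A>_eq by simp
    ultimately show "?Q k" using A by (auto simp: fchain.cospans_def)
  next
    fix k assume "?Q k"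
    then obtain A where A: "finite A" "card A = k" "A \<subseteq> ?Z" "?Z \<subseteq> fchain.span (A \<union> ?B)"
      by (auto simp: fchain.cospans_def)
    then have "V.span (homology_class n T ` A) = carrier ?V"
      using homology_gen_set_iff by blast
    moreover have "homology_class n T ` A \<subseteq> carrier ?V"
      using A(3) by (auto simp: field_homology_simps)
    ultimately have "?P (card (homology_class n T ` A))" using A(1) by blast
    then show "\<exists>j\<le>k. ?P j" using card_image_le[OF A(1)] A(2) by blast
  qed
  then show ?thesis by (simp add: betti_def V.dim_def fchain.corank_def)
qed

section \<open>Homology of discs relative to their boundary\<close>

definition disc_space :: "nat \<Rightarrow> (nat \<Rightarrow> real) topology"
  where "disc_space m = subtopology (Euclidean_space m) (closed_disc m)"

abbreviation disc_boundary :: "nat \<Rightarrow> (nat \<Rightarrow> real) set"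
  where "disc_boundary m \<equiv> closed_disc m - open_disc m"

text \<open>Euclidean space sits in the product topology on all sequences, which is the type-class
  topology; this form gives access to \<open>continuous_on\<close> and
  \<open>compact\<close>.\<close>

lemma disc_space_eq: "disc_space m = top_of_set (closed_disc m)"
proof -
  have "closed_disc m = topspace (Euclidean_space m) \<inter> closed_disc m"
    by (auto simp: closed_disc_def)
  then show ?thesis
    unfolding disc_space_def
    by (metis Euclidean_space_def euclidean_product_topology subtopology_subtopology topspace_Euclidean_space)
qed

lemma topspace_disc_space [simp]: "topspace (disc_space m) = closed_disc m"
  by (simp add: disc_space_eq)

lemma closed_disc_iff: "x \<in> closed_disc m \<longleftrightarrow> (\<forall>i\<ge>m. x i = 0) \<and> (\<Sum>i<m. (x i)\<^sup>2) \<le> 1"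
  and open_disc_iff: "x \<in> open_disc m \<longleftrightarrow> (\<forall>i\<ge>m. x i = 0) \<and> (\<Sum>i<m. (x i)\<^sup>2) < 1"
  by (simp_all add: closed_disc_def open_disc_def topspace_Euclidean_space)

lemma open_disc_subset: "open_disc m \<subseteq> closed_disc m"
  by (auto simp: closed_disc_iff open_disc_iff)

lemma continuous_on_coordinate [continuous_intros]:
  "continuous_on S (\<lambda>x :: nat \<Rightarrow> real. x i)"
  by (rule continuous_on_product_then_coordinatewise) (rule continuous_on_id)

lemma continuous_on_coordinate_snd [continuous_intros]:
  "continuous_on S (\<lambda>p :: 'b::topological_space \<times> (nat \<Rightarrow> real). snd p i)"
  by (rule continuous_on_product_then_coordinatewise) (rule continuous_on_snd[OF continuous_on_id])

text \<open>A closed subset of a cube with infinitely many coordinates, compact by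
  Tychonoff.\<close>

lemma compact_closed_disc: "compact (closed_disc m)"
proof -
  have "compactin (powertop_real UNIV) (PiE UNIV (\<lambda>i. {-1..1}))"
    by (simp add: compactin_PiE)
  then have "compact (PiE UNIV (\<lambda>i::nat. {-1..1::real}))"
    by (simp add: euclidean_product_topology)
  moreover have "closed (closed_disc m)"
  proof -
    have "closed_disc m = (\<Inter>i\<in>{m..}. {x. x i = 0}) \<inter> {x. (\<Sum>i<m. (x i)\<^sup>2) \<le> 1}"
      by (auto simp: closed_disc_iff)
    moreover have "closed (\<Inter>i\<in>{m..}. {x :: nat \<Rightarrow> real. x i = 0})"
      by (intro closed_INT ballI closed_Collect_eq continuous_intros)
    moreover have "closed {x :: nat \<Rightarrow> real. (\<Sum>i<m. (x i)\<^sup>2) \<le> 1}"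
      by (intro closed_Collect_le continuous_intros)
    ultimately show ?thesis by (simp add: closed_Int)
  qed
  moreover have "closed_disc m \<subseteq> PiE UNIV (\<lambda>i. {-1..1})"
  proof (clarsimp simp: PiE_UNIV_domain)
    fix x i assume x: "x \<in> closed_disc m"
    have "(x i)\<^sup>2 \<le> 1"
    proof (cases "i < m")
      case True
      then have "(x i)\<^sup>2 \<le> (\<Sum>i<m. (x i)\<^sup>2)" by (intro member_le_sum) auto
      then show ?thesis using x by (simp add: closed_disc_iff)
    qed (use x in \<open>simp add: closed_disc_iff\<close>)
    then show "- 1 \<le> x i \<and> x i \<le> 1" using abs_square_le_1[of "x i"] by auto
  qed
  ultimately show ?thesis by (metis compact_Int_closed inf.absorb_iff2)
qed

definition norm2 :: "nat \<Rightarrow> (nat \<Rightarrow> real) \<Rightarrow> real"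
  where "norm2 m x = sqrt (\<Sum>i<m. (x i)\<^sup>2)"

lemma norm2_nonneg [simp]: "0 \<le> norm2 m x"
  by (simp add: norm2_def sum_nonneg)

lemma norm2_scale: "norm2 m (\<lambda>i. r * x i) = \<bar>r\<bar> * norm2 m x"
proof -
  have "(\<Sum>i<m. (r * x i)\<^sup>2) = r\<^sup>2 * (\<Sum>i<m. (x i)\<^sup>2)"
    by (simp add: power_mult_distrib sum_distrib_left)
  then show ?thesis by (simp add: norm2_def real_sqrt_mult)
qed

lemma continuous_on_norm2 [continuous_intros]: "continuous_on S (norm2 m)"
  unfolding norm2_def by (intro continuous_intros)

lemma continuous_on_norm2_snd [continuous_intros]:
  "continuous_on S (\<lambda>p :: 'b::topological_space \<times> (nat \<Rightarrow> real). norm2 m (snd p))"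
  unfolding norm2_def by (intro continuous_intros)

lemma closed_disc_norm2: "x \<in> closed_disc m \<longleftrightarrow> (\<forall>i\<ge>m. x i = 0) \<and> norm2 m x \<le> 1"
  and open_disc_norm2: "x \<in> open_disc m \<longleftrightarrow> (\<forall>i\<ge>m. x i = 0) \<and> norm2 m x < 1"
  by (auto simp: closed_disc_iff open_disc_iff norm2_def)

lemma contractible_disc_space: "contractible_space (disc_space m)"
proof -
  let ?h = "\<lambda>(t::real, x) i. (1 - t) * x i :: real"
  have "continuous_on ({0..1} \<times> closed_disc m) ?h"
    unfolding case_prod_beta by (intro continuous_intros)
  moreover have "?h \<in> {0..1} \<times> closed_disc m \<rightarrow> closed_disc m"
  proof clarify
    fix t :: real and x assume t: "t \<in> {0..1}" and x: "x \<in> closed_disc m"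
    have "\<bar>1 - t\<bar> * norm2 m x \<le> 1"
      by (rule mult_le_one) (use t x in \<open>auto simp: closed_disc_norm2\<close>)
    then show "(\<lambda>i. (1 - t) * x i) \<in> closed_disc m"
      using x by (simp add: closed_disc_norm2 norm2_scale)
  qed
  ultimately have "continuous_map (prod_topology (top_of_set {0..1}) (disc_space m)) (disc_space m) ?h"
    unfolding disc_space_eq prod_topology_subtopology_eu continuous_map_subtopology_eu by simp
  moreover have "?h (0, x) = id x" "?h (1, x) = (\<lambda>_. 0)" for x
    by (simp_all add: fun_eq_iff)
  ultimately have "homotopic_with (\<lambda>_. True) (disc_space m) (disc_space m) id (\<lambda>_ _. 0)"
    unfolding homotopic_with_def by blast
  then show ?thesis unfolding contractible_space_def by blast
qed

lemma disc_boundary_nsphere: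
  assumes "m \<ge> 1" shows "subtopology (disc_space m) (disc_boundary m) = nsphere (m - 1)"
proof -
  obtain n where n: "m = Suc n" using assms by (cases m) auto
  have "closed_disc m \<inter> (disc_boundary m) = topspace (Euclidean_space m) \<inter> {x. (\<Sum>i\<le>n. (x i)\<^sup>2) = 1}"
    by (auto simp: closed_disc_def open_disc_def n lessThan_Suc_atMost)
  then have "subtopology (disc_space m) (disc_boundary m)
      = subtopology (Euclidean_space m) (topspace (Euclidean_space m) \<inter> {x. (\<Sum>i\<le>n. (x i)\<^sup>2) = 1})"
    by (simp only: disc_space_def subtopology_subtopology)
  also have "\<dots> = nsphere (m - 1)"
    unfolding nsphere_def n diff_Suc_1 by (rule subtopology_restrict)
  finally show ?thesis .
qed

section \<open>Relative homology of the disc and its generating chain\<close>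

lemma cyclic_relative_homology_group_generator:
  assumes "cyclic_group (relative_homology_group (int p) X S)"
  obtains w where "singular_relcycle p X S w"
    "\<And>c. singular_relcycle p X S c \<Longrightarrow> \<exists>j. homologous_rel p X S c (frag_cmul j w)"
proof -
  let ?H = "relative_homology_group (int p) X S"
  obtain x where x: "x \<in> carrier ?H" "carrier ?H = range (\<lambda>n::int. x [^]\<^bsub>?H\<^esub> n)"
    using assms group.cyclic_group[OF group_relative_homology_group] by blast
  from x(1) obtain w where w: "singular_relcycle p X S w" "x = homologous_rel_set p X S w"
    unfolding carrier_relative_homology_group by blast
  have keys: "Poly_Mapping.keys w \<subseteq> singular_simplex_set p X"
    using w(1) by (auto simp: singular_relcycle singular_chain_def)
  have "w \<in> carrier (subgroup_generated (chain_group p X) (singular_relcycle_set p X S))"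
    using w(1) carrier_relcycle_group[of p X S] by (simp add: relcycle_group_def)
  then have "w [^]\<^bsub>relcycle_group p X S\<^esub> n = frag_cmul n w" for n :: int
    using keys group.int_pow_subgroup_generated[OF group_chain_group, of w p X _ n]
    by (simp add: relcycle_group_def chain_group_def)
  then have pow: "x [^]\<^bsub>?H\<^esub> n = homologous_rel_set p X S (frag_cmul n w)" for n :: int
    using w(1) right_coset_singular_relboundary[of p X S]
      normal.FactGroup_int_pow[OF normal_subgroup_singular_relboundary_relcycle, of w p X S n]
    by (simp add: relative_homology_group_def w(2))
  have "\<exists>j. homologous_rel p X S c (frag_cmul j w)" if "singular_relcycle p X S c" for c
  proof -
    have "homologous_rel_set p X S c \<in> carrier ?H"
      using that by (simp add: carrier_relative_homology_group)
    then show ?thesis using x(2) by (auto simp: pow homologous_rel_set_eq homologous_rel_eq)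
  qed
  then show ?thesis using that w(1) by blast
qed

text \<open>The long exact sequence of the pair, with the disc contractible. The hypothesis on
  \<open>m\<close> makes the boundary sphere nonempty.\<close>

lemma relative_homology_group_disc:
  assumes "m \<ge> 1"
  shows "relative_homology_group p (disc_space m) (disc_boundary m)
    \<cong> reduced_homology_group (p - 1) (nsphere (m - 1))"
proof -
  have "topspace (nsphere (m - 1)) = topspace (disc_space m) \<inter> disc_boundary m"
    by (metis disc_boundary_nsphere[OF assms] topspace_subtopology)
  then have "topspace (disc_space m) \<inter> disc_boundary m \<noteq> {}"
    using in_topspace_nsphere[of "m - 1"] by blast
  then show ?thesis
    using isomorphic_group_relative_homology_of_contractible[OF contractible_disc_space]
      disc_boundary_nsphere[OF assms] by metis
qed

text \<open>The connecting isomorphism lowers the degree by one, and the reduced homology of the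
  sphere of dimension \<open>m - 1\<close> lives only in degree \<open>m - 1\<close>.\<close>

lemma disc_relcycle_imp_relboundary:
  assumes "k < m" and c: "singular_relcycle k (disc_space m) (disc_boundary m) c"
  shows "singular_relboundary k (disc_space m) (disc_boundary m) c"
proof -
  let ?H = "relative_homology_group (int k) (disc_space m) (disc_boundary m)"
  have "trivial_group (reduced_homology_group (int k - 1) (nsphere (m - 1)))"
    using assms(1) by (simp add: trivial_reduced_homology_group_nsphere)
  then have "trivial_group ?H"
    using isomorphic_group_triviality[OF relative_homology_group_disc[of m "int k"]] assms(1) by simp
  moreover have "homologous_rel_set k (disc_space m) (disc_boundary m) c \<in> carrier ?H"
    using c by (simp add: carrier_relative_homology_group)
  ultimately show ?thesis
    by (simp add: trivial_group_def homologous_rel_set_eq_relboundary)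
qed

lemma disc_relcycle_generator:
  assumes "m \<ge> 1"
  obtains w where "singular_relcycle m (disc_space m) (disc_boundary m) w"
    "\<And>c. singular_relcycle m (disc_space m) (disc_boundary m) c
      \<Longrightarrow> \<exists>j. homologous_rel m (disc_space m) (disc_boundary m) c (frag_cmul j w)"
proof -
  have "cyclic_group (relative_homology_group (int m) (disc_space m) (disc_boundary m))"
    using isomorphic_group_cyclicity[OF relative_homology_group_disc[OF assms, of "int m"]]
    by (simp add: cyclic_reduced_homology_group_nsphere)
  then show ?thesis by (rule cyclic_relative_homology_group_generator) (rule that)
qed

section \<open>Attaching a cell\<close>

lemma compact_disc_space: "compact_space (disc_space m)"
  by (simp add: disc_space_eq compact_space_subtopology compact_closed_disc)

text \<open>A straight-line homotopy from the identity to division by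
  \<open>max (norm2 m x) (1/2)\<close>. At time 1 the shell \<open>1/2 \<le> norm2 m x\<close> lands
  on the sphere; the maximum avoids the singularity of radial projection at the centre. Any radius
  strictly between 0 and 1 could replace \<open>1/2\<close>.\<close>

definition radial_push :: "nat \<Rightarrow> real \<Rightarrow> (nat \<Rightarrow> real) \<Rightarrow> nat \<Rightarrow> real"
  where "radial_push m t x = (\<lambda>i. (1 - t + t / max (norm2 m x) (1/2)) * x i)"

lemma norm2_radial_push:
  assumes t: "0 \<le> t" "t \<le> 1"
  shows "norm2 m (radial_push m t x) = (1 - t) * norm2 m x + t * (norm2 m x / max (norm2 m x) (1/2))"
proof -
  have "0 \<le> 1 - t + t / max (norm2 m x) (1/2)"
    by (intro add_nonneg_nonneg divide_nonneg_nonneg) (use t in auto)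
  then show ?thesis
    unfolding radial_push_def norm2_scale by (simp add: abs_of_nonneg algebra_simps)
qed

lemma radial_push_closed_disc:
  assumes "0 \<le> t" "t \<le> 1" "x \<in> closed_disc m" shows "radial_push m t x \<in> closed_disc m"
proof -
  have "norm2 m x / max (norm2 m x) (1/2) \<le> 1"
    by (auto simp: divide_le_eq_1)
  then have "(1 - t) * norm2 m x + t * (norm2 m x / max (norm2 m x) (1/2)) \<le> (1 - t) * 1 + t * 1"
    using assms by (intro add_mono mult_left_mono) (auto simp: closed_disc_norm2)
  then show ?thesis
    using assms by (simp add: closed_disc_norm2 norm2_radial_push) (simp add: radial_push_def)
qed

lemma disc_boundary_norm2: "x \<in> disc_boundary m \<longleftrightarrow> (\<forall>i\<ge>m. x i = 0) \<and> norm2 m x = 1"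
  by (auto simp: closed_disc_norm2 open_disc_norm2)

lemma radial_push_boundary:
  assumes "x \<in> closed_disc m" "1/2 \<le> norm2 m x" shows "radial_push m 1 x \<in> disc_boundary m"
  unfolding disc_boundary_norm2
  using assms by (auto simp: norm2_radial_push closed_disc_norm2 max_def) (auto simp: radial_push_def)

lemma radial_push_fixed: "x \<in> disc_boundary m \<Longrightarrow> radial_push m t x = x"
  by (simp add: radial_push_def disc_boundary_norm2 del: Diff_iff)

lemma radial_push_0 [simp]: "radial_push m 0 x = x"
  by (simp add: radial_push_def)

lemma continuous_map_radial_push:
  "continuous_map (prod_topology (top_of_set {0..1}) (disc_space m)) (disc_space m)
    (\<lambda>(t, x). radial_push m t x)"
proof -
  have "continuous_on ({0..1} \<times> closed_disc m) (\<lambda>(t, x). radial_push m t x)"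
    unfolding case_prod_beta radial_push_def
    by (intro continuous_intros) auto
  moreover have "(\<lambda>(t, x). radial_push m t x) \<in> {0..1} \<times> closed_disc m \<rightarrow> closed_disc m"
    using radial_push_closed_disc by auto
  ultimately show ?thesis
    unfolding disc_space_eq prod_topology_subtopology_eu continuous_map_subtopology_eu by blast
qed

text \<open>An adjunction space described from inside: since the disc is compact and
  \<open>T\<close> is Hausdorff, \<Phi> is a closed map, so the topology is the expected
  quotient.\<close>

locale cell_attachment =
  fixes T :: "'a topology" and Y :: "'a set" and m :: nat and \<Phi> :: "(nat \<Rightarrow> real) \<Rightarrow> 'a"
  assumes Hausdorff: "Hausdorff_space T"
    and continuous_\<Phi>: "continuous_map (disc_space m) T \<Phi>"
    and inj_\<Phi>: "inj_on \<Phi> (open_disc m)"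
    and closed_Y: "closedin T Y"
    and topspace_T: "topspace T = Y \<union> \<Phi> ` open_disc m"
    and disjoint: "Y \<inter> \<Phi> ` open_disc m = {}"
    and boundary: "\<Phi> ` disc_boundary m \<subseteq> Y"
begin

definition pull :: "'a \<Rightarrow> nat \<Rightarrow> real"
  where "pull = inv_into (open_disc m) \<Phi>"

lemma pull_\<Phi> [simp]: "x \<in> open_disc m \<Longrightarrow> pull (\<Phi> x) = x"
  by (simp add: pull_def inj_\<Phi>)

lemma closed_map_\<Phi>: "closed_map (disc_space m) T \<Phi>"
proof (rule continuous_imp_closed_map_gen)
  show "compact_space (disc_space m)" by (rule compact_disc_space)
  show "kc_space T" using Hausdorff by (rule Hausdorff_imp_kc_space)
qed (rule continuous_\<Phi>)

lemma \<Phi>_in_cell_iff: "x \<in> closed_disc m \<Longrightarrow> \<Phi> x \<in> \<Phi> ` open_disc m \<longleftrightarrow> x \<in> open_disc m"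
  using boundary disjoint by blast

text \<open>The preimage of the open cell in the closed disc is exactly the open disc, so the closed
  map \<Phi> restricts to a closed bijection between them, hence to a homeomorphism.\<close>

lemma continuous_map_pull:
  "continuous_map (subtopology T (\<Phi> ` open_disc m)) (subtopology (disc_space m) (open_disc m)) pull"
proof -
  let ?D = "subtopology (disc_space m) (open_disc m)" and ?e = "subtopology T (\<Phi> ` open_disc m)"
  have top: "topspace ?D = open_disc m" using open_disc_subset[of m] by (simp add: inf.absorb2)
  have tope: "topspace ?e = \<Phi> ` open_disc m" using topspace_T by auto
  have "homeomorphic_map ?D ?e \<Phi>"
  proof (rule bijective_closed_imp_homeomorphic_map)
    show "continuous_map ?D ?e \<Phi>"
      using continuous_\<Phi> top by (auto simp: continuous_map_in_subtopology continuous_map_from_subtopology)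
    show "closed_map ?D ?e \<Phi>"
      using \<Phi>_in_cell_iff open_disc_subset
      by (intro closed_map_restriction[OF closed_map_\<Phi>]) auto
  qed (simp_all only: top tope inj_\<Phi>)
  then obtain g where g: "homeomorphic_maps ?D ?e \<Phi> g" using homeomorphic_map_maps by blast
  then have "g y = pull y" if "y \<in> topspace ?e" for y
    using that tope top by (auto simp: homeomorphic_maps_def)
  with g show ?thesis
    by (auto simp: homeomorphic_maps_def intro: continuous_map_eq)
qed

definition push :: "real \<times> 'a \<Rightarrow> 'a"
  where "push = (\<lambda>(t, y). if y \<in> Y then y else \<Phi> (radial_push m t (pull y)))"

lemma push_\<Phi>: "x \<in> closed_disc m \<Longrightarrow> push (t, \<Phi> x) = \<Phi> (radial_push m t x)"
proof (cases "x \<in> open_disc m")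
  case True
  then have "\<Phi> x \<notin> Y" using disjoint by blast
  then show ?thesis using True by (simp add: push_def)
next
  case False
  moreover assume "x \<in> closed_disc m"
  ultimately have x: "x \<in> disc_boundary m" by blast
  then have "\<Phi> x \<in> Y" using boundary by blast
  then show ?thesis using radial_push_fixed[OF x] by (simp add: push_def)
qed

lemma push_Y: "y \<in> Y \<Longrightarrow> push (t, y) = y"
  by (simp add: push_def)

lemma topspace_cases:
  assumes "y \<in> topspace T"
  obtains "y \<in> Y" | x where "x \<in> open_disc m" "x \<in> closed_disc m" "y = \<Phi> x" "y \<notin> Y"
  using assms topspace_T disjoint open_disc_subset by blast

text \<open>The preimage of a closed set is a union of two closed sets: the part over
  \<open>Y\<close>, where \<open>push\<close> is a projection, and the image of a closed subset of
  interval times disc. The latter is closed because it comes from a compact space mapped to a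
  Hausdorff one.\<close>

lemma continuous_map_push: "continuous_map (prod_topology (top_of_set {0..1}) T) T push"
  unfolding continuous_map_closedin
proof (intro conjI ballI allI impI Pi_I)
  fix p assume p: "p \<in> topspace (prod_topology (top_of_set {0..1::real}) T)"
  obtain t y where ty: "p = (t, y)" "0 \<le> t" "t \<le> 1" "y \<in> topspace T" using p by auto
  from ty(4) show "push p \<in> topspace T"
  proof (cases rule: topspace_cases)
    case 1
    then show ?thesis using ty push_Y by simp
  next
    case (2 x)
    then have "radial_push m t x \<in> topspace (disc_space m)"
      using ty radial_push_closed_disc by simp
    then show ?thesis
      using 2 ty push_\<Phi> continuous_map_image_subset_topspace[OF continuous_\<Phi>] by auto
  qed
next
  let ?I = "top_of_set {0..1::real}"
  fix C assume C: "closedin T C"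
  let ?P = "{p \<in> topspace (prod_topology ?I (disc_space m)). \<Phi> (radial_push m (fst p) (snd p)) \<in> C}"
  have "continuous_map (prod_topology ?I (disc_space m)) T (\<lambda>p. \<Phi> (radial_push m (fst p) (snd p)))"
    using continuous_map_compose[OF continuous_map_radial_push continuous_\<Phi>]
    by (simp add: o_def case_prod_beta)
  then have "closedin (prod_topology ?I (disc_space m)) ?P"
    using closedin_continuous_map_preimage C by blast
  moreover have "closed_map (prod_topology ?I (disc_space m)) (prod_topology ?I T) (\<lambda>p. (fst p, \<Phi> (snd p)))"
  proof (rule continuous_imp_closed_map_gen)
    show "compact_space (prod_topology ?I (disc_space m))"
      unfolding disc_space_eq prod_topology_subtopology_eu
      by (intro compact_space_subtopology) (simp add: compact_Times compact_closed_disc)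
    show "kc_space (prod_topology ?I T)"
      by (intro Hausdorff_imp_kc_space) (simp add: Hausdorff_space_prod_topology Hausdorff Hausdorff_space_subtopology)
    show "continuous_map (prod_topology ?I (disc_space m)) (prod_topology ?I T) (\<lambda>p. (fst p, \<Phi> (snd p)))"
      using continuous_map_compose[OF continuous_map_snd continuous_\<Phi>]
      by (simp add: continuous_map_pairwise o_def continuous_map_fst)
  qed
  ultimately have 1: "closedin (prod_topology ?I T) ((\<lambda>p. (fst p, \<Phi> (snd p))) ` ?P)"
    by (simp add: closed_map_def)
  have 2: "closedin (prod_topology ?I T) ({0..1} \<times> (Y \<inter> C))"
    using closed_Y C by (simp add: closedin_prod_Times_iff closedin_Int)
  have "{p \<in> topspace (prod_topology ?I T). push p \<in> C}
    = {0..1} \<times> (Y \<inter> C) \<union> (\<lambda>p. (fst p, \<Phi> (snd p))) ` ?P" (is "?L = ?R")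
  proof
    show "?L \<subseteq> ?R"
    proof
      fix p assume p: "p \<in> ?L"
      then obtain t y where ty: "p = (t, y)" "t \<in> {0..1}" "y \<in> topspace T" "push (t, y) \<in> C" by auto
      from ty(3) show "p \<in> ?R"
      proof (cases rule: topspace_cases)
        case 1
        then show ?thesis using ty push_Y[OF 1, of t] by simp
      next
        case (2 x)
        then have "(t, x) \<in> ?P" using ty push_\<Phi>[of x t] by simp
        then have "(\<lambda>p. (fst p, \<Phi> (snd p))) (t, x) \<in> (\<lambda>p. (fst p, \<Phi> (snd p))) ` ?P" by (rule imageI)
        then show ?thesis using 2 ty by simp
      qed
    qed
    show "?R \<subseteq> ?L"
      using push_Y push_\<Phi> closedin_subset[OF C] continuous_map_image_subset_topspace[OF continuous_\<Phi>]
      by auto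
  qed
  then show "closedin (prod_topology ?I T) {p \<in> topspace (prod_topology ?I T). push p \<in> C}"
    using closedin_Un[OF 2 1] by simp
qed

text \<open>
  Subdivide \<open>c\<close> into simplices that lie in the open cell or avoid the disc of radius \<open>1/2\<close> in it. The
  homotopy \<open>push\<close> fixes \<open>Y\<close> and moves the simplices of the second kind into \<open>Y\<close>.
\<close>

lemma relcycle_homologous_image_disc:
  assumes c: "singular_relcycle k T Y c"
  obtains w where "singular_relcycle k (disc_space m) (disc_boundary m) w"
    "homologous_rel k T Y c (chain_map k \<Phi> w)"
proof -
  let ?e = "\<Phi> ` open_disc m" and ?\<rho> = "\<lambda>y. push (1, y)"
  define U where "U = topspace T - \<Phi> ` {x \<in> closed_disc m. norm2 m x \<le> 1/2}"
  have YT: "Y \<subseteq> topspace T" using closed_Y closedin_subset by blast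
  have small: "{x \<in> closed_disc m. norm2 m x \<le> 1/2} \<subseteq> open_disc m"
    by (auto simp: closed_disc_norm2 open_disc_norm2)
  have "openin T U"
  proof -
    have "closed {x :: nat \<Rightarrow> real. norm2 m x \<le> 1/2}"
      by (intro closed_Collect_le continuous_intros)
    then have "closedin (disc_space m) {x \<in> closed_disc m. norm2 m x \<le> 1/2}"
      unfolding disc_space_eq closedin_closed by (intro exI[of _ "{x. norm2 m x \<le> 1/2}"]) auto
    then show ?thesis using closed_map_\<Phi> by (auto simp: closed_map_def U_def)
  qed
  moreover have "openin T ?e"
  proof -
    have "?e = topspace T - Y" using topspace_T disjoint by blast
    then show ?thesis using closed_Y by (simp add: openin_diff)
  qed
  moreover have "topspace T \<subseteq> \<Union>{U, ?e}" using small by (auto simp: U_def)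
  ultimately obtain c' where c': "singular_relcycle k T Y c'" "homologous_rel k T Y c c'"
    "\<And>f. f \<in> Poly_Mapping.keys c' \<Longrightarrow> \<exists>V\<in>{U, ?e}. f \<in> standard_simplex k \<rightarrow> V"
    using small_homologous_rel_relcycle_exists[of "{U, ?e}" T k Y c] c by blast
  let ?in = "\<lambda>V. {f. singular_simplex k (subtopology T V) f}"
  have "singular_chain k T c'" using c'(1) by (simp add: singular_relcycle)
  then have "Poly_Mapping.keys c' \<subseteq> ?in U \<union> ?in ?e"
    using c'(3) by (fastforce simp: singular_chain_def singular_simplex_subtopology image_subset_iff_funcset)
  then obtain c1 c2 where "Poly_Mapping.keys c1 \<subseteq> ?in U" "Poly_Mapping.keys c2 \<subseteq> ?in ?e"
    and sum: "c1 + c2 = c'"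
    using frag_split by metis
  then have c1: "singular_chain k (subtopology T U) c1" and c2: "singular_chain k (subtopology T ?e) c2"
    by (auto simp: singular_chain_def)
  have YU: "Y \<subseteq> U" using YT disjoint small by (auto simp: U_def)
  \<comment> \<open>The boundary of \<open>c2\<close> is the difference of two chains in
    \<open>U\<close> and also lies in the open cell, so \<open>c2\<close> is a relative cycle of the
    cell modulo the open shell \<open>?e \<inter> U\<close>.\<close>
  have "singular_chain (k - 1) (subtopology T U) (chain_boundary k c')"
    using c'(1) YU singular_chain_mono by (auto simp: singular_relcycle)
  then have "singular_chain (k - 1) (subtopology T U) (chain_boundary k c' - chain_boundary k c1)"
    using singular_chain_boundary[OF c1] by (simp add: singular_chain_diff)
  moreover have "chain_boundary k c' - chain_boundary k c1 = chain_boundary k c2"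
    by (simp add: chain_boundary_add flip: sum)
  ultimately have "singular_relcycle k (subtopology T ?e) (?e \<inter> U) c2"
    using c2 singular_chain_boundary[OF c2]
    by (auto simp: singular_relcycle subtopology_subtopology singular_chain_subtopology)
  \<comment> \<open>In disc coordinates the push at time 1 takes this shell to the sphere and so
    turns \<open>c2\<close> into a relative cycle of the disc.\<close>
  moreover have g: "continuous_map (subtopology T ?e) (disc_space m) (radial_push m 1 \<circ> pull)"
  proof (rule continuous_map_compose)
    show "continuous_map (subtopology T ?e) (disc_space m) pull"
      using continuous_map_pull by (simp add: continuous_map_in_subtopology)
    have "continuous_map (disc_space m) (prod_topology (top_of_set {0..1}) (disc_space m)) (\<lambda>x. (1::real, x))"
      by (simp add: continuous_map_pairwise o_def)
    from continuous_map_compose[OF this continuous_map_radial_push]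
    show "continuous_map (disc_space m) (disc_space m) (radial_push m 1)" by (simp add: o_def)
  qed
  moreover have "radial_push m 1 \<circ> pull \<in> ?e \<inter> U \<rightarrow> disc_boundary m"
  proof
    fix y assume y: "y \<in> ?e \<inter> U"
    then obtain x where x: "x \<in> open_disc m" "y = \<Phi> x" by blast
    then have "x \<in> closed_disc m" using open_disc_subset by blast
    moreover from this have "\<not> norm2 m x \<le> 1/2" using x y by (auto simp: U_def)
    ultimately have "radial_push m 1 x \<in> disc_boundary m" by (intro radial_push_boundary) auto
    then show "(radial_push m 1 \<circ> pull) y \<in> disc_boundary m" using x by simp
  qed
  ultimately have w: "singular_relcycle k (disc_space m) (disc_boundary m) (chain_map k (radial_push m 1 \<circ> pull) c2)"
    by (rule singular_relcycle_chain_map)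
  have "chain_map k \<Phi> (chain_map k (radial_push m 1 \<circ> pull) c2) = chain_map k (\<Phi> \<circ> (radial_push m 1 \<circ> pull)) c2"
    by (simp add: chain_map_compose)
  also have "\<dots> = chain_map k ?\<rho> c2"
    by (rule chain_map_eq[OF c2]) (use push_\<Phi> subsetD[OF open_disc_subset] in auto)
  finally have \<Phi>w: "chain_map k \<Phi> (chain_map k (radial_push m 1 \<circ> pull) c2) = chain_map k ?\<rho> c2" .
  have "homotopic_with (\<lambda>h. h \<in> Y \<rightarrow> Y) T T (\<lambda>y. push (0, y)) ?\<rho>"
    unfolding homotopic_with_def
    by (intro exI[of _ push]) (auto simp: continuous_map_push push_Y)
  then have "homologous_rel k T Y (chain_map k (\<lambda>y. push (0, y)) c') (chain_map k ?\<rho> c')"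
    using homotopic_imp_homologous_rel_chain_maps c'(1) by blast
  moreover have "chain_map k (\<lambda>y. push (0, y)) c' = c'"
  proof (rule chain_map_id_gen)
    show "singular_chain k T c'" by fact
    show "push (0, y) = y" if "y \<in> topspace T" for y
      using that by (cases rule: topspace_cases) (auto simp: push_Y push_\<Phi>)
  qed
  \<comment> \<open>The remaining part \<open>c1\<close> is pushed into \<open>Y\<close> and
    contributes nothing modulo \<open>Y\<close>.\<close>
  moreover have "homologous_rel k T Y (chain_map k ?\<rho> c') (chain_map k ?\<rho> c2)"
  proof -
    have "continuous_map (subtopology T U) (subtopology T Y) ?\<rho>"
      unfolding continuous_map_in_subtopology
    proof
      have "continuous_map T (prod_topology (top_of_set {0..1}) T) (\<lambda>x. (1::real, x))"
        by (simp add: continuous_map_pairwise o_def)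
      from continuous_map_compose[OF this continuous_map_push]
      show "continuous_map (subtopology T U) T ?\<rho>" by (simp add: o_def continuous_map_from_subtopology)
      show "?\<rho> \<in> topspace (subtopology T U) \<rightarrow> Y"
      proof
        fix y assume "y \<in> topspace (subtopology T U)"
        then have y: "y \<in> topspace T" "y \<in> U" by auto
        from y(1) show "push (1, y) \<in> Y"
        proof (cases rule: topspace_cases)
          case 1 then show ?thesis by (simp add: push_Y)
        next
          case (2 x)
          then have "\<not> norm2 m x \<le> 1/2" using y by (auto simp: U_def)
          then have "radial_push m 1 x \<in> disc_boundary m" using 2 by (intro radial_push_boundary) auto
          then show ?thesis using 2 boundary push_\<Phi>[of x 1] by auto
        qed
      qed
    qed
    then have "singular_chain k (subtopology T Y) (chain_map k ?\<rho> c1)"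
      using singular_chain_chain_map[OF c1] by blast
    then show ?thesis
      unfolding homologous_rel_def
      by (auto simp: chain_map_add intro: singular_chain_imp_relboundary simp flip: sum)
  qed
  ultimately have "homologous_rel k T Y c' (chain_map k ?\<rho> c2)"
    using homologous_rel_trans by metis
  then have "homologous_rel k T Y c (chain_map k ?\<rho> c2)"
    using homologous_rel_trans c'(2) by metis
  then show ?thesis using that[OF w] \<Phi>w by simp
qed

lemma relcycle_imp_relboundary:
  assumes "k < m" and c: "singular_relcycle k T Y c" shows "singular_relboundary k T Y c"
proof -
  obtain w where w: "singular_relcycle k (disc_space m) (disc_boundary m) w"
    "homologous_rel k T Y c (chain_map k \<Phi> w)"
    using relcycle_homologous_image_disc[OF c] .
  have "singular_relboundary k T Y (chain_map k \<Phi> w)"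
    using disc_relcycle_imp_relboundary[OF assms(1) w(1)] continuous_\<Phi> boundary
    by (intro singular_relboundary_chain_map) auto
  with w(2) show ?thesis
    unfolding homologous_rel_def using singular_relboundary_add by fastforce
qed

lemma relcycle_homologous_multiple:
  assumes gen: "\<And>w. singular_relcycle m (disc_space m) (disc_boundary m) w
      \<Longrightarrow> \<exists>j. homologous_rel m (disc_space m) (disc_boundary m) w (frag_cmul j w0)"
    and c: "singular_relcycle m T Y c"
  shows "\<exists>j. homologous_rel m T Y c (frag_cmul j (chain_map m \<Phi> w0))"
proof -
  obtain w where w: "singular_relcycle m (disc_space m) (disc_boundary m) w"
    "homologous_rel m T Y c (chain_map m \<Phi> w)"
    using relcycle_homologous_image_disc[OF c] .
  obtain j where "homologous_rel m (disc_space m) (disc_boundary m) w (frag_cmul j w0)"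
    using gen[OF w(1)] by blast
  then have "singular_relboundary m T Y (chain_map m \<Phi> (w - frag_cmul j w0))"
    unfolding homologous_rel_def
    using continuous_\<Phi> boundary by (intro singular_relboundary_chain_map) auto
  then have "homologous_rel m T Y (chain_map m \<Phi> w) (frag_cmul j (chain_map m \<Phi> w0))"
    by (simp add: homologous_rel_def chain_map_diff)
  then show ?thesis using homologous_rel_trans w(2) by blast
qed

end

section \<open>Effect of one cell on cycles and boundaries over the field\<close>

lemma field_boundaries_mono:
  "S \<subseteq> S' \<Longrightarrow> field_boundaries n (subtopology T S) \<subseteq> field_boundaries n (subtopology T S')"
  unfolding field_boundaries_def by (intro image_mono field_chains_mono)

lemma field_cycles_mono:
  "S \<subseteq> S' \<Longrightarrow> field_cycles n (subtopology T S) \<subseteq> field_cycles n (subtopology T S')"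
  unfolding field_cycles_def using field_chains_mono by blast

context cell_attachment
begin

text \<open>Surjectivity of the map on degree-\<open>n\<close> homology from \<open>Y\<close> to
  \<open>T\<close>. Modulo chains in \<open>Y\<close>, \<open>z\<close> combines integral relative
  cycles, and each of these is a boundary modulo \<open>Y\<close>. The leftover chain in
  \<open>Y\<close> differs from \<open>z\<close> by a boundary, so it is itself a cycle.\<close>

lemma field_cycle_decompose:
  assumes "n < m" and z: "z \<in> field_cycles n T"
  shows "\<exists>y\<in>field_cycles n (subtopology T Y). z - y \<in> field_boundaries n T"
proof -
  have "z \<in> field_chains n T" "field_boundary n z \<in> field_chains (n - 1) (subtopology T Y)"
    using z by (simp_all add: field_cycles_def field_chains_closed)
  then obtain a b where ab: "z = a + b" "a \<in> fchain.span (of_frag ` singular_relcycle_set n T Y)"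
    "b \<in> field_chains n (subtopology T Y)"
    using field_relcycle_decompose[of n T Y z] relcycle_imp_relboundary assms(1) less_trans by blast
  let ?P = "{x + y | x y. x \<in> field_boundaries n T \<and> y \<in> field_chains n (subtopology T Y)}"
  have "of_frag c \<in> ?P" if c: "singular_relcycle n T Y c" for c
  proof -
    obtain d e where de: "singular_chain (Suc n) T d" "singular_chain n (subtopology T Y) e"
      "chain_boundary (Suc n) d = c + e"
      using relcycle_imp_relboundary[OF assms(1) c] by (auto simp: singular_relboundary_alt)
    then have "c = chain_boundary (Suc n) d + (- e)" by simp
    then have "of_frag c = of_frag (chain_boundary (Suc n) d) + of_frag (- e)"
      by (simp only: of_frag_simps(2))
    moreover have "of_frag (chain_boundary (Suc n) d) \<in> field_boundaries n T"
      unfolding field_boundaries_def field_boundary_of_frag[symmetric]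
      by (intro imageI of_frag_in_field_chains de(1))
    moreover have "of_frag (- e) \<in> field_chains n (subtopology T Y)"
      using de(2) by (intro of_frag_in_field_chains) (simp add: singular_chain_minus)
    ultimately show ?thesis by blast
  qed
  then have "fchain.span (of_frag ` singular_relcycle_set n T Y) \<subseteq> ?P"
    by (intro fchain.span_minimal fchain.subspace_sums field_boundaries_subspace field_chains_subspace) auto
  then obtain x y where xy: "a = x + y" "x \<in> field_boundaries n T" "y \<in> field_chains n (subtopology T Y)"
    using ab(2) by blast
  have eq: "z - (y + b) = x" and eq': "y + b = z - x" using ab(1) xy(1) by simp_all
  have "field_boundary n x = 0" "field_boundary n z = 0"
    using z xy(2) field_boundaries_subset_cycles by (auto simp: field_cycles_def)
  then have "field_boundary n (y + b) = 0"
    by (simp add: eq' field_boundary_linear)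
  then have "y + b \<in> field_cycles n (subtopology T Y)"
    using xy(3) ab(3) by (simp add: field_cycles_def field_chains_closed)
  then show ?thesis using eq xy(2) by auto
qed

text \<open>The kernel of the same map when the cell has dimension \<open>n + 1\<close>. A chain
  bounded by \<open>b\<close> is a relative cycle; modulo chains in \<open>Y\<close> and boundaries
  it is a multiple of the image of \<open>w0\<close>, and taking boundaries gives the claim.\<close>

lemma field_boundary_decompose:
  fixes b :: "('a, 'k::field) field_chain"
  assumes m: "m = Suc n"
    and w0: "singular_relcycle m (disc_space m) (disc_boundary m) w0"
    and gen: "\<And>w. singular_relcycle m (disc_space m) (disc_boundary m) w
      \<Longrightarrow> \<exists>j. homologous_rel m (disc_space m) (disc_boundary m) w (frag_cmul j w0)"
    and b: "b \<in> field_boundaries n T" "b \<in> field_chains n (subtopology T Y)"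
  shows "\<exists>r. b - fscale r (of_frag (chain_boundary m (chain_map m \<Phi> w0))) \<in> field_boundaries n (subtopology T Y)"
proof -
  define z :: "('a, 'k) field_chain" where "z = of_frag (chain_boundary m (chain_map m \<Phi> w0))"
  obtain c where c: "c \<in> field_chains m T" "b = field_boundary m c"
    using b(1) m by (auto simp: field_boundaries_def)
  then obtain x y where xy: "c = x + y" "x \<in> fchain.span (of_frag ` singular_relcycle_set m T Y)"
    "y \<in> field_chains m (subtopology T Y)"
    using field_relcycle_decompose[OF relcycle_imp_relboundary c(1)] b(2) m
    by (metis diff_Suc_1)
  have y: "field_boundary m y \<in> field_boundaries n (subtopology T Y)"
    using xy(3) m by (auto simp: field_boundaries_def)
  \<comment> \<open>The coefficient over the field arises from integral ones: \<open>?P\<close> is a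
    subspace, and on integral relative cycles an integer multiple of the generator suffices.\<close>
  let ?P = "{x. \<exists>r. field_boundary m x - fscale r z \<in> field_boundaries n (subtopology T Y)}"
  have "fchain.subspace ?P"
  proof (rule fchain.subspaceI)
    show "0 \<in> ?P" by (auto intro!: exI[of _ 0] simp: field_boundary_linear field_boundaries_closed)
    show "u + v \<in> ?P" if u: "u \<in> ?P" and v: "v \<in> ?P" for u v
    proof -
      obtain r s where "field_boundary m u - fscale r z \<in> field_boundaries n (subtopology T Y)"
        "field_boundary m v - fscale s z \<in> field_boundaries n (subtopology T Y)"
        using u v by blast
      then have "(field_boundary m u - fscale r z) + (field_boundary m v - fscale s z)
          \<in> field_boundaries n (subtopology T Y)"
        by (rule field_boundaries_closed)
      then show ?thesis
        by (auto intro!: exI[of _ "r + s"]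
            simp: field_boundary_linear fchain.scale_left_distrib add_diff_add)
    qed
    show "fscale s u \<in> ?P" if u: "u \<in> ?P" for s u
    proof -
      obtain r where "field_boundary m u - fscale r z \<in> field_boundaries n (subtopology T Y)"
        using u by blast
      then have "fscale s (field_boundary m u - fscale r z) \<in> field_boundaries n (subtopology T Y)"
        by (rule field_boundaries_closed)
      then show ?thesis
        by (auto intro!: exI[of _ "s * r"]
            simp: field_boundary_linear fchain.scale_right_diff_distrib)
    qed
  qed
  moreover have "of_frag v \<in> ?P" if v: "singular_relcycle m T Y v" for v
  proof -
    obtain j where "homologous_rel m T Y v (frag_cmul j (chain_map m \<Phi> w0))"
      using relcycle_homologous_multiple[OF gen v] by blast
    then obtain d e where de: "singular_chain (Suc m) T d" "singular_chain m (subtopology T Y) e"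
      "chain_boundary (Suc m) d = v - frag_cmul j (chain_map m \<Phi> w0) + e"
      by (auto simp: homologous_rel_def singular_relboundary_alt)
    then have "v = chain_boundary (Suc m) d + frag_cmul j (chain_map m \<Phi> w0) - e" by simp
    then have "chain_boundary m v
        = frag_cmul j (chain_boundary m (chain_map m \<Phi> w0)) + chain_boundary m (- e)"
      by (simp add: chain_boundary_diff chain_boundary_add chain_boundary_cmul chain_boundary_minus
          chain_boundary_boundary_alt[OF de(1)])
    then have "field_boundary m (of_frag v) - fscale (of_int j) z = field_boundary m (of_frag (- e))"
      by (simp add: field_boundary_of_frag z_def)
    moreover have "field_boundary m (of_frag (- e)) \<in> field_boundaries n (subtopology T Y)"
      using of_frag_in_field_chains[of m _ "- e"] de(2) m
      by (auto simp: field_boundaries_def singular_chain_minus)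
    ultimately show ?thesis unfolding mem_Collect_eq by metis
  qed
  ultimately have "fchain.span (of_frag ` singular_relcycle_set m T Y) \<subseteq> ?P"
    by (intro fchain.span_minimal) auto
  then obtain r where "field_boundary m x - fscale r z \<in> field_boundaries n (subtopology T Y)"
    using xy(2) by blast
  then have "(field_boundary m x - fscale r z) + field_boundary m y \<in> field_boundaries n (subtopology T Y)"
    using y by (rule field_boundaries_closed)
  moreover have "(field_boundary m x - fscale r z) + field_boundary m y = b - fscale r z"
    by (simp add: c(2) xy(1) field_boundary_linear)
  ultimately show ?thesis unfolding z_def by auto
qed

end

section \<open>Attaching top-dimensional cells to a skeleton\<close>

context finite_cell_complex
begin

definition carrier_set :: "'c set \<Rightarrow> 'a set"
  where "carrier_set Y = (\<Union>c\<in>Y. open_cell X c)"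

lemma carrier_set_mono: "Y \<subseteq> Y' \<Longrightarrow> carrier_set Y \<subseteq> carrier_set Y'"
  by (auto simp: carrier_set_def)

lemma carrier_set_topspace: "Y \<subseteq> cells X \<Longrightarrow> carrier_set Y \<subseteq> topspace (total_space X)"
  using carrier_set_mono[of Y "cells X"] Union_open_cells by (simp add: carrier_set_def)

lemma subcomplex_space_eq: "subcomplex_space X Y = subtopology (total_space X) (carrier_set Y)"
  by (simp add: subcomplex_space_def carrier_set_def)

lemma continuous_char_map_disc:
  "c \<in> cells X \<Longrightarrow> continuous_map (disc_space (cell_dim X c)) (total_space X) (char_map X c)"
  using continuous_char_map by (simp add: disc_space_def)

text \<open>By \<open>down\<close>, the boundaries of the cells stay inside, so the union of the
  open cells is a finite union of compact closed cells.\<close>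

lemma closedin_carrier_set:
  assumes Y: "Y \<subseteq> cells X"
    and down: "\<And>c c'. c \<in> Y \<Longrightarrow> c' \<in> cells X \<Longrightarrow> cell_dim X c' < cell_dim X c \<Longrightarrow> c' \<in> Y"
  shows "closedin (total_space X) (carrier_set Y)"
proof -
  let ?C = "\<lambda>c. char_map X c ` closed_disc (cell_dim X c)"
  have "carrier_set Y = (\<Union>c\<in>Y. ?C c)"
  proof
    show "carrier_set Y \<subseteq> (\<Union>c\<in>Y. ?C c)"
      unfolding carrier_set_def open_cell_def by (intro UN_mono image_mono open_disc_subset subset_refl)
    show "(\<Union>c\<in>Y. ?C c) \<subseteq> carrier_set Y"
    proof (intro UN_least subsetI)
      fix c y assume c: "c \<in> Y" and "y \<in> ?C c"
      then obtain x where x: "x \<in> closed_disc (cell_dim X c)" "y = char_map X c x" by blast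
      show "y \<in> carrier_set Y"
      proof (cases "x \<in> open_disc (cell_dim X c)")
        case True
        then show ?thesis using c x by (auto simp: carrier_set_def open_cell_def)
      next
        case False
        then have "y \<in> (\<Union>c'\<in>{c' \<in> cells X. cell_dim X c' < cell_dim X c}. open_cell X c')"
          using char_map_boundary[of c] c Y x by blast
        then show ?thesis using down[OF c] by (auto simp: carrier_set_def)
      qed
    qed
  qed
  moreover have "closedin (total_space X) (?C c)" if "c \<in> Y" for c
  proof (rule compactin_imp_closedin[OF Hausdorff])
    have "compactin (disc_space (cell_dim X c)) (closed_disc (cell_dim X c))"
      using compact_disc_space[of "cell_dim X c"] by (simp add: compact_space_def)
    then show "compactin (total_space X) (?C c)"
      using continuous_char_map_disc that Y by (intro image_compactin) auto
  qed
  moreover have "finite Y" using Y finite_cells finite_subset by blast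
  ultimately show ?thesis by (auto intro: closedin_Union)
qed

section \<open>Homology of the skeleton with a set of top-dimensional cells attached\<close>

context
  fixes n :: nat
begin

definition attached :: "'c set \<Rightarrow> 'a set"
  where "attached F = carrier_set (skeleton X n \<union> F)"

abbreviation top_cells :: "'c set"
  where "top_cells \<equiv> cells_of_dim X (Suc n) (cells X)"

lemma finite_top_cells: "finite top_cells"
  using finite_cells by (simp add: cells_of_dim_def)

lemma attached_mono: "F \<subseteq> G \<Longrightarrow> attached F \<subseteq> attached G"
  unfolding attached_def by (intro carrier_set_mono) auto

lemma skeleton_top_cells_disjoint: "skeleton X n \<inter> top_cells = {}"
  by (auto simp: skeleton_def cells_of_dim_def)

text \<open>The boundary of an \<open>(n+1)\<close>-cell lies in the \<open>n\<close>-skeleton, so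
  the cells can be attached in any order.\<close>

lemma cell_attachment_top_cell:
  assumes F: "F \<subseteq> top_cells" and e: "e \<in> top_cells" "e \<notin> F"
  shows "cell_attachment (subtopology (total_space X) (attached (insert e F))) (attached F) (Suc n) (char_map X e)"
proof -
  have eX: "e \<in> cells X" "cell_dim X e = Suc n" using e by (auto simp: cells_of_dim_def)
  have FX: "skeleton X n \<union> F \<subseteq> cells X" "skeleton X n \<union> insert e F \<subseteq> cells X"
    using F eX by (auto simp: skeleton_def cells_of_dim_def)
  have open_e: "char_map X e ` open_disc (Suc n) = open_cell X e" by (simp add: open_cell_def eX)
  have ins: "attached (insert e F) = attached F \<union> open_cell X e"
    by (auto simp: attached_def carrier_set_def)
  have bd: "char_map X e ` disc_boundary (Suc n) \<subseteq> attached F"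
    using char_map_boundary[OF eX(1)] unfolding eX(2)
    by (force simp: attached_def carrier_set_def skeleton_def)
  show ?thesis
  proof
    show "Hausdorff_space (subtopology (total_space X) (attached (insert e F)))"
      by (intro Hausdorff_space_subtopology Hausdorff)
    have "char_map X e ` closed_disc (Suc n) \<subseteq> attached (insert e F)"
      using bd open_e ins by blast
    then show "continuous_map (disc_space (Suc n)) (subtopology (total_space X) (attached (insert e F))) (char_map X e)"
      using continuous_char_map_disc[OF eX(1)] eX(2) by (auto simp: continuous_map_in_subtopology)
    show "inj_on (char_map X e) (open_disc (Suc n))" using inj_on_char_map[OF eX(1)] eX(2) by simp
    have "closedin (total_space X) (attached F)"
      unfolding attached_def
      by (rule closedin_carrier_set[OF FX(1)]) (use F in \<open>auto simp: skeleton_def cells_of_dim_def\<close>)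
    then show "closedin (subtopology (total_space X) (attached (insert e F))) (attached F)"
      using ins by (intro closedin_subset_topspace) auto
    show "topspace (subtopology (total_space X) (attached (insert e F))) = attached F \<union> char_map X e ` open_disc (Suc n)"
      using carrier_set_topspace[OF FX(2)] ins open_e by (auto simp: attached_def)
    have "e \<notin> skeleton X n" using eX by (simp add: skeleton_def)
    then show "attached F \<inter> char_map X e ` open_disc (Suc n) = {}"
      unfolding open_e
      using disjoint_open_cells eX(1) FX(1) e(2)
      by (fastforce simp: disjoint_family_on_def attached_def carrier_set_def)
  qed (rule bd)
qed

lemma subtopology_attached:
  "F \<subseteq> G \<Longrightarrow> subtopology (subtopology (total_space X) (attached G)) (attached F)
    = subtopology (total_space X) (attached F)"
  using attached_mono[of F G] by (simp add: subtopology_subtopology inf.absorb2)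

abbreviation attached_space :: "'c set \<Rightarrow> 'a topology"
  where "attached_space F \<equiv> subtopology (total_space X) (attached F)"

lemma attached_cycle_decompose:
  assumes "F \<subseteq> top_cells" and z: "z \<in> field_cycles n (attached_space F)"
  shows "\<exists>y\<in>field_cycles n (attached_space {}). z - y \<in> field_boundaries n (attached_space F)"
proof -
  have "finite F" using assms(1) finite_top_cells finite_subset by blast
  then show ?thesis using assms
  proof (induction F arbitrary: z rule: finite_induct)
    case empty
    then show ?case by (intro bexI[of _ z]) (simp_all add: field_boundaries_closed)
  next
    case (insert e F)
    interpret cell_attachment "attached_space (insert e F)" "attached F" "Suc n" "char_map X e"
      using insert by (intro cell_attachment_top_cell) auto
    obtain y where y: "y \<in> field_cycles n (attached_space F)"
      "z - y \<in> field_boundaries n (attached_space (insert e F))"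
      using field_cycle_decompose[of n z] insert.prems by (auto simp: subtopology_attached subset_insertI)
    obtain x where x: "x \<in> field_cycles n (attached_space {})" "y - x \<in> field_boundaries n (attached_space F)"
      using insert y(1) by blast
    have "y - x \<in> field_boundaries n (attached_space (insert e F))"
      using x(2) field_boundaries_mono[OF attached_mono[OF subset_insertI]] by blast
    then have "(z - y) + (y - x) \<in> field_boundaries n (attached_space (insert e F))"
      using y(2) by (intro field_boundaries_closed)
    then show ?case using x(1) by auto
  qed
qed

context
  fixes w0 :: "(nat \<Rightarrow> real) chain"
  assumes w0: "singular_relcycle (Suc n) (disc_space (Suc n)) (disc_boundary (Suc n)) w0"
    and gen: "\<And>w. singular_relcycle (Suc n) (disc_space (Suc n)) (disc_boundary (Suc n)) w
      \<Longrightarrow> \<exists>j. homologous_rel (Suc n) (disc_space (Suc n)) (disc_boundary (Suc n)) w (frag_cmul j w0)"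
begin

text \<open>One integral generator \<open>w0\<close> of the disc serves all cells. The cycle
  represents the image of the sphere's generator under the attaching map.\<close>

definition attaching_cycle :: "'c \<Rightarrow> ('a, 'k::field) field_chain"
  where "attaching_cycle e = of_frag (chain_boundary (Suc n) (chain_map (Suc n) (char_map X e) w0))"

text \<open>Attaching \<open>e\<close> to the bare skeleton places its attaching cycle there,
  whichever other cells are present later.\<close>

lemma attaching_relcycle:
  assumes "e \<in> top_cells"
  shows "singular_relcycle (Suc n) (attached_space {e}) (attached {}) (chain_map (Suc n) (char_map X e) w0)"
proof -
  interpret cell_attachment "attached_space {e}" "attached {}" "Suc n" "char_map X e"
    using assms by (intro cell_attachment_top_cell) auto
  show ?thesis using w0 continuous_\<Phi> boundary by (intro singular_relcycle_chain_map) auto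
qed

lemma attaching_cycle_in_cycles:
  assumes "e \<in> top_cells" shows "attaching_cycle e \<in> field_cycles n (attached_space {})"
proof -
  have "singular_chain (Suc n) (attached_space {e}) (chain_map (Suc n) (char_map X e) w0)"
    "singular_chain n (attached_space {}) (chain_boundary (Suc n) (chain_map (Suc n) (char_map X e) w0))"
    using attaching_relcycle[OF assms] by (simp_all add: singular_relcycle subtopology_attached)
  then show ?thesis
    by (simp add: field_cycles_def attaching_cycle_def of_frag_in_field_chains field_boundary_of_frag
        chain_boundary_boundary_alt)
qed

lemma attaching_cycle_in_boundaries:
  assumes "e \<in> F" "e \<in> top_cells" shows "attaching_cycle e \<in> field_boundaries n (attached_space F)"
proof -
  have "singular_chain (Suc n) (attached_space {e}) (chain_map (Suc n) (char_map X e) w0)"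
    using attaching_relcycle[OF assms(2)] by (simp add: singular_relcycle)
  then have "singular_chain (Suc n) (attached_space F) (chain_map (Suc n) (char_map X e) w0)"
    using singular_chain_mono attached_mono[of "{e}" F] assms(1) by blast
  then show ?thesis
    by (auto simp: field_boundaries_def attaching_cycle_def of_frag_in_field_chains
        simp flip: field_boundary_of_frag)
qed

text \<open>When \<open>e\<close> is attached, a skeleton cycle that bounds becomes, after
  subtracting a multiple of the attaching cycle of \<open>e\<close>, one that bounded before. The
  difference is again a cycle of the skeleton, so the induction continues.\<close>

lemma attached_boundaries:
  assumes "F \<subseteq> top_cells"
  shows "(field_boundaries n (attached_space F) :: ('a, 'k::field) field_chain set) \<inter> field_cycles n (attached_space {})
    = fchain.span (field_boundaries n (attached_space {}) \<union> attaching_cycle ` F)" (is "?L F = ?R F")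
proof
  show "?R F \<subseteq> ?L F"
  proof (rule fchain.span_minimal)
    show "field_boundaries n (attached_space {}) \<union> attaching_cycle ` F \<subseteq> ?L F"
      using attaching_cycle_in_cycles attaching_cycle_in_boundaries assms
        field_boundaries_mono[OF attached_mono[of "{}" F]] field_boundaries_subset_cycles by fastforce
  qed (intro fchain.subspace_inter field_boundaries_subspace field_cycles_subspace)
  have "finite F" using assms finite_top_cells finite_subset by blast
  then show "?L F \<subseteq> ?R F" using assms
  proof (induction F rule: finite_induct)
    case empty
    then show ?case by (auto intro: fchain.span_base)
  next
    case (insert e F)
    interpret cell_attachment "attached_space (insert e F)" "attached F" "Suc n" "char_map X e"
      using insert by (intro cell_attachment_top_cell) auto
    show ?case
    proof
      fix b :: "('a, 'k) field_chain" assume b: "b \<in> ?L (insert e F)"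
      have "b \<in> field_chains n (attached_space F)"
        using b field_chains_mono[OF attached_mono[of "{}" F]] by (auto simp: field_cycles_def)
      then obtain r where r: "b - fscale r (attaching_cycle e) \<in> field_boundaries n (attached_space F)"
        using field_boundary_decompose[OF refl w0 gen, of b] b
        by (auto simp: attaching_cycle_def subtopology_attached subset_insertI)
      moreover have "attaching_cycle e \<in> field_cycles n (attached_space {})"
        using insert.prems by (intro attaching_cycle_in_cycles) auto
      then have "b - fscale r (attaching_cycle e) \<in> field_cycles n (attached_space {})"
        using b by (intro fchain.subspace_diff field_cycles_subspace field_cycles_closed) auto
      ultimately have "b - fscale r (attaching_cycle e) \<in> ?R F" using insert by blast
      moreover have "?R F \<subseteq> ?R (insert e F)" by (intro fchain.span_mono) auto
      moreover have "fscale r (attaching_cycle e) \<in> ?R (insert e F)"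
        by (intro fchain.span_scale fchain.span_base) auto
      ultimately have "(b - fscale r (attaching_cycle e)) + fscale r (attaching_cycle e) \<in> ?R (insert e F)"
        by (intro fchain.span_add) auto
      then show "b \<in> ?R (insert e F)" by simp
    qed
  qed
qed

text \<open>The space of cycles on the right no longer depends on \<open>F\<close>; only the
  spanning vectors do. This is the form to which supermodularity of the corank applies.\<close>

lemma betti_attached:
  assumes "F \<subseteq> top_cells"
  shows "betti TYPE('k::field) n (attached_space F)
    = fchain.corank (field_cycles n (attached_space {}) :: ('a, 'k) field_chain set)
        (field_boundaries n (attached_space {}) \<union> attaching_cycle ` F)"
proof -
  let ?Z = "\<lambda>F. field_cycles n (attached_space F) :: ('a, 'k) field_chain set"
  let ?B = "\<lambda>F. field_boundaries n (attached_space F) :: ('a, 'k) field_chain set"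
  have "betti TYPE('k::field) n (attached_space F) = fchain.corank (?Z F) (?B F)"
    by (rule betti_eq_corank)
  also have "\<dots> = fchain.corank (?Z {}) (?B F \<inter> ?Z {})"
    by (intro fchain.corank_restrict field_cycles_subspace field_boundaries_subspace
        field_cycles_mono attached_mono attached_cycle_decompose assms) auto
  also have "\<dots> = fchain.corank (?Z {}) (?B {} \<union> attaching_cycle ` F)"
    by (rule fchain.corank_cong_span) (simp add: attached_boundaries[OF assms] fchain.span_span)
  finally show ?thesis .
qed

end

section \<open>Supermodular Betti numbers and the lattice condition for the weights\<close>

lemma betti_attached_supermodular:
  assumes "F \<subseteq> top_cells" "G \<subseteq> top_cells"
  shows "betti TYPE('k::field) n (attached_space F) + betti TYPE('k) n (attached_space G)
    \<le> betti TYPE('k) n (attached_space (F \<union> G)) + betti TYPE('k) n (attached_space (F \<inter> G))"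
proof -
  obtain w0 where w0: "singular_relcycle (Suc n) (disc_space (Suc n)) (disc_boundary (Suc n)) w0"
    "\<And>w. singular_relcycle (Suc n) (disc_space (Suc n)) (disc_boundary (Suc n)) w
      \<Longrightarrow> \<exists>j. homologous_rel (Suc n) (disc_space (Suc n)) (disc_boundary (Suc n)) w (frag_cmul j w0)"
    using disc_relcycle_generator[of "Suc n"] by auto
  have sub: "F \<union> G \<subseteq> top_cells" "F \<inter> G \<subseteq> top_cells" using assms by auto
  have "finite F" "finite G" using assms finite_top_cells finite_subset by blast+
  moreover have "attaching_cycle w0 ` (F \<union> G) \<subseteq> (field_cycles n (attached_space {}) :: ('a, 'k) field_chain set)"
    using attaching_cycle_in_cycles[OF w0] sub(1) by blast
  ultimately have "fchain.corank (field_cycles n (attached_space {}) :: ('a, 'k) field_chain set)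
        (field_boundaries n (attached_space {}) \<union> attaching_cycle w0 ` F)
      + fchain.corank (field_cycles n (attached_space {}) :: ('a, 'k) field_chain set)
        (field_boundaries n (attached_space {}) \<union> attaching_cycle w0 ` G)
    \<le> fchain.corank (field_cycles n (attached_space {}) :: ('a, 'k) field_chain set)
        (field_boundaries n (attached_space {}) \<union> attaching_cycle w0 ` (F \<union> G))
      + fchain.corank (field_cycles n (attached_space {}) :: ('a, 'k) field_chain set)
        (field_boundaries n (attached_space {}) \<union> attaching_cycle w0 ` (F \<inter> G))"
    by (rule fchain.corank_supermodular)
  moreover have "betti TYPE('k) n (attached_space H)
    = fchain.corank (field_cycles n (attached_space {}) :: ('a, 'k) field_chain set)
        (field_boundaries n (attached_space {}) \<union> attaching_cycle w0 ` H)"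
    if "H \<subseteq> top_cells" for H
    by (rule betti_attached[OF w0 that])
  ultimately show ?thesis by (simp only: assms sub)
qed

lemma subcomplex_space_attached: "subcomplex_space X (skeleton X n \<union> F) = attached_space F"
  by (simp add: subcomplex_space_eq attached_def)

text \<open>The exponents of \<open>p\<close> and \<open>1 - p\<close> are modular in the set of
  cells, so they agree on both sides. Only the exponent of \<open>q\<close> can grow, and
  \<open>q\<close> is at least 1.\<close>

lemma rc_weight_lattice:
  assumes F: "F \<subseteq> top_cells" and G: "G \<subseteq> top_cells" and pq: "0 < p" "p < 1" "1 \<le> q"
  shows "rc_weight TYPE('k::field) X (Suc n) p q (skeleton X n \<union> F) * rc_weight TYPE('k) X (Suc n) p q (skeleton X n \<union> G)
    \<le> rc_weight TYPE('k) X (Suc n) p q (skeleton X n \<union> (F \<union> G)) * rc_weight TYPE('k) X (Suc n) p q (skeleton X n \<union> (F \<inter> G))"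
proof -
  have sub: "F \<union> G \<subseteq> top_cells" "F \<inter> G \<subseteq> top_cells" using F G by auto
  have fin: "finite F" "finite G" using F G finite_top_cells finite_subset by blast+
  let ?b = "\<lambda>F. betti TYPE('k) n (attached_space F)"
  have w: "rc_weight TYPE('k) X (Suc n) p q (skeleton X n \<union> H)
      = p ^ card H * (1 - p) ^ card (top_cells - H) * q ^ ?b H" if "H \<subseteq> top_cells" for H
  proof -
    have "cells_of_dim X (Suc n) (skeleton X n \<union> H) = H"
      using that by (auto simp: cells_of_dim_def skeleton_def)
    then show ?thesis by (simp add: rc_weight_def subcomplex_space_attached)
  qed
  have 1: "card F + card G = card (F \<union> G) + card (F \<inter> G)"
    using fin by (rule card_Un_Int)
  have "card (top_cells - F) + card (top_cells - G)
    = card ((top_cells - F) \<union> (top_cells - G)) + card ((top_cells - F) \<inter> (top_cells - G))"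
    using finite_top_cells by (intro card_Un_Int) auto
  then have 2: "card (top_cells - F) + card (top_cells - G)
    = card (top_cells - (F \<union> G)) + card (top_cells - (F \<inter> G))"
    by (simp only: Diff_Un Diff_Int add.commute)
  have "rc_weight TYPE('k) X (Suc n) p q (skeleton X n \<union> F) * rc_weight TYPE('k) X (Suc n) p q (skeleton X n \<union> G)
    = p ^ (card F + card G) * (1 - p) ^ (card (top_cells - F) + card (top_cells - G)) * q ^ (?b F + ?b G)"
    by (simp only: w F G power_add mult_ac)
  also have "\<dots> \<le> p ^ (card F + card G) * (1 - p) ^ (card (top_cells - F) + card (top_cells - G))
      * q ^ (?b (F \<union> G) + ?b (F \<inter> G))"
    using pq betti_attached_supermodular[OF F G] by (intro mult_left_mono power_increasing) auto
  also have "\<dots> = rc_weight TYPE('k) X (Suc n) p q (skeleton X n \<union> (F \<union> G))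
      * rc_weight TYPE('k) X (Suc n) p q (skeleton X n \<union> (F \<inter> G))"
    by (simp only: w sub 1 2 power_add mult_ac)
  finally show ?thesis .
qed

end

end

theorem theorem5p1:
  fixes X :: "('a, 'c) cell_complex"
    and l :: nat
    and p q :: real
    and f g :: "'c set \<Rightarrow> real"
  assumes "finite_cell_complex X"
    and "l \<ge> 1"
    and "0 < p" and "p < 1" and "q \<ge> 1"
    and "monotone_on (configurations X l) (\<subseteq>) (\<le>) f"
    and "monotone_on (configurations X l) (\<subseteq>) (\<le>) g"
  shows "(LINT Y|rc_measure TYPE('k::field) X l p q. f Y * g Y) \<ge>
         (LINT Y|rc_measure TYPE('k) X l p q. f Y) * (LINT Y|rc_measure TYPE('k) X l p q. g Y)"
proof -
  interpret finite_cell_complex X by fact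
  \<comment> \<open>Makes the truncated \<open>l - 1\<close> in both the skeleton and the
    homological degree equal to \<open>n\<close>.\<close>
  obtain n where n: "l = Suc n" using assms(2) by (cases l) auto
  let ?L = "cells_of_dim X (Suc n) (cells X)" and ?s = "\<lambda>F. skeleton X n \<union> F"
  define w where "w = (\<lambda>F. rc_weight TYPE('k) X l p q (?s F))"
  define Z where "Z = sum w (Pow ?L)"
  have w_pos: "0 < w F" for F
    using assms(3-5) by (simp add: w_def rc_weight_def)
  have finL: "finite (Pow ?L)" using finite_top_cells by simp
  have conf: "configurations X l = ?s ` Pow ?L" by (auto simp: configurations_def n)
  \<comment> \<open>Together with \<open>conf\<close>, this identifies the configurations with the
    Boolean lattice of sets of \<open>l\<close>-cells, where \<open>FKG_sum\<close> applies.\<close>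
  have inj: "inj_on ?s (Pow ?L)"
  proof (rule inj_on_inverseI)
    show "?s F - skeleton X n = F" if "F \<in> Pow ?L" for F
      using that skeleton_top_cells_disjoint[of n] by blast
  qed
  have Z_pos: "0 < Z" unfolding Z_def using finL w_pos by (intro sum_pos) auto
  have part: "rc_partition TYPE('k) X l p q = Z"
    by (simp add: rc_partition_def conf sum.reindex[OF inj] Z_def w_def)
  have LINT: "(LINT Y|rc_measure TYPE('k) X l p q. h Y) = (\<Sum>F\<in>Pow ?L. h (?s F) * w F) / Z" for h :: "'c set \<Rightarrow> real"
  proof -
    have "(LINT Y|rc_measure TYPE('k) X l p q. h Y)
      = (\<Sum>Y\<in>configurations X l. (rc_weight TYPE('k) X l p q Y / Z) *\<^sub>R h Y)"
      unfolding rc_measure_def part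
    proof (rule lebesgue_integral_point_measure_finite)
      show "finite (configurations X l)" unfolding conf by (rule finite_imageI[OF finL])
      show "0 \<le> rc_weight TYPE('k) X l p q Y / Z" if "Y \<in> configurations X l" for Y
        using that w_pos Z_pos unfolding conf w_def by (auto intro!: divide_nonneg_pos less_imp_le)
    qed
    also have "\<dots> = (\<Sum>F\<in>Pow ?L. h (?s F) * w F) / Z"
      unfolding conf sum.reindex[OF inj] sum_divide_distrib
      by (rule sum.cong) (simp_all add: w_def)
    finally show ?thesis .
  qed
  have mono: "monotone_on (Pow ?L) (\<subseteq>) (\<le>) (\<lambda>F. h (?s F))"
    if "monotone_on (configurations X l) (\<subseteq>) (\<le>) h" for h :: "'c set \<Rightarrow> real"
  proof (rule monotone_onI)
    show "h (?s A) \<le> h (?s B)" if "A \<in> Pow ?L" "B \<in> Pow ?L" "A \<subseteq> B" for A B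
      by (rule monotone_onD[OF \<open>monotone_on _ _ _ h\<close>]) (use that in \<open>auto simp: conf\<close>)
  qed
  have "(\<Sum>F\<in>Pow ?L. f (?s F) * w F) * (\<Sum>F\<in>Pow ?L. g (?s F) * w F)
    \<le> (\<Sum>F\<in>Pow ?L. f (?s F) * g (?s F) * w F) * sum w (Pow ?L)"
  proof (rule FKG_sum[OF finite_top_cells _ _ mono[OF assms(6)] mono[OF assms(7)]])
    show "0 \<le> w A" for A using w_pos[of A] by simp
    show "w A * w B \<le> w (A \<union> B) * w (A \<inter> B)" if "A \<subseteq> ?L" "B \<subseteq> ?L" for A B
      unfolding w_def n by (rule rc_weight_lattice[OF that assms(3-5)])
  qed
  \<comment> \<open>Dividing by \<open>Z * Z\<close> normalises both expectations on the left; on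
    the right one factor \<open>Z\<close> cancels.\<close>
  then have "(\<Sum>F\<in>Pow ?L. f (?s F) * w F) * (\<Sum>F\<in>Pow ?L. g (?s F) * w F) / (Z * Z)
    \<le> (\<Sum>F\<in>Pow ?L. f (?s F) * g (?s F) * w F) * Z / (Z * Z)"
    unfolding Z_def[symmetric] using Z_pos by (intro divide_right_mono) simp_all
  then show ?thesis
    unfolding LINT using Z_pos by simp
qed

end
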